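(* Consider Problem (P) under Assumption (A) over a graph satisfying Assumption (B), and run SONATA with weights satisfying (W) and surrogates satisfying (C), with $\tilde\mu_{\min}\ge D^\ell_{\min}$. Define $\bar a=\tilde\mu_{\min}/(\tilde\mu_{\min}-D^\ell_{\min})$ (interpreted as $+\infty$ if $\tilde\mu_{\min}=D^\ell_{\min}$, in which case $G_P^\star$ below is constant in $\alpha$ and $G_P^\star(\bar a)$ denotes that constant), $$G_P^\star(\alpha)=\frac{\frac{D_{\max}^2}{\mu}+\frac1\mu\big((1-\frac\alpha2)\tilde\mu_{\min}+\frac{D^\ell_{\min}}2\alpha\big)^2}{\big((1-\frac\alpha2)\tilde\mu_{\min}+\frac{D^\ell_{\min}}2\alpha\big)^2},\quad C_1=\frac6\mu\Big(\big(\tfrac{D_{\max}}{\tilde\mu_{\min}}+1\big)^2+\frac{4L_{\max}^2}{\tilde\mu_{\min}^2}\Big),\quad C_2=\frac4{\tilde\mu_{\min}^2},$$ $A_1=2G_P^\star(\bar a)C_1\cdot4L_{\max}^2\rho^2$, $A_2=(4G_P^\star(\bar a)C_1+C_2)\cdot2L_{\max}^2\rho^2$, $A_3=(4G_P^\star(\bar a)C_1+C_2)\cdot8L_{\max}^2\rho^4$, $A_{1/2}=\sqrt{A_1+A_2+A_3}$, $J=\frac12\cdot\frac{\tilde\mu_{\min}\mu}{4D_{\max}^2+\tilde\mu_{\min}\mu}$, $$\alpha^*=\Big(\frac{-\rho\sqrt{A_{1/2}}+\sqrt{A_{1/2}+J(1-\rho^2)}}{A_{1/2}+J}\Big)^2,\qquad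 \alpha_{\max}=\min\Big\{\frac{(1-\rho)^2}{A_{1/2}},\ \bar a,\ 1\Big\}.$$ If $\alpha\in(0,\alpha_{\max})$, then for all $i\in\{1,\dots,m\}$, $U(x_i^\nu)-U^\star=O(z^\nu)$, where $z=1-J\alpha$ if $\alpha\in(0,\min\{\alpha^*,\alpha_{\max}\})$, and $z=\big(\rho+\sqrt{\alpha A_{1/2}}\big)^2$ if $\alpha\in[\min\{\alpha^*,\alpha_{\max}\},\alpha_{\max})$.
   Context: Problem (P): minimize $U(x):=F(x)+G(x)$ over $x\in\mathcal K$, $F=\frac1m\sum_{i=1}^mf_i$. Assumption (A): $\mathcal K\subseteq\mathbb R^d$ nonempty closed convex; each $f_i$ twice differentiable and convex on an open $\mathcal O\supseteq\mathcal K$; $\mu I\preceq\nabla^2F(x)\preceq LI$ on $\mathcal K$ with $\mu>0,L<\infty$; $G:\mathcal K\to\mathbb R$ convex. $U^\star$ is the optimal value. For each $i$, $\nabla^2f_i(x)\preceq L_iI$ on $\mathcal K$ with $L_i<\infty$; $L_{\max}=\max_iL_i$. (B): connected undirected graph on $\{1,\dots,m\}$ with edges $\mathcal E$. (W): $w_{ii}>0$; for $i\ne j$, $w_{ij}>0$ iff $(i,j)\in\mathcal E$, else $0$; $W$ doubly stochastic. $\rho$ is the largest singular value of $W\otimes I_d-\frac1m\mathbf 1\mathbf 1^\top\otimes I_d$ (so $\rho<1$). (C): $\tilde f_i:\mathcal O\times\mathcal O\to\mathbb R$ is $C^2$, $\nabla\tilde f_i(x;x)=\nabla f_i(x)$,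 $\nabla\tilde f_i(\cdot;x)$ is $\tilde L_i$-Lipschitz and $\tilde f_i(\cdot;x)$ is $\tilde\mu_i$-strongly convex on $\mathcal K$, for all $x\in\mathcal K$ (derivatives in the first argument). Constants $D_i^\ell\le D_i^u$ satisfy $D_i^\ell I\preceq\nabla^2\tilde f_i(x;y)-\nabla^2F(x)\preceq D_i^uI$ for all $x,y\in\mathcal K$; $D_i=\max\{|D_i^\ell|,|D_i^u|\}$, $\tilde\mu_{\min}=\min_i\tilde\mu_i$, $D^\ell_{\min}=\min_iD_i^\ell$, $D_{\max}=\max_iD_i$. SONATA with step-size $\alpha$: $x_i^0\in\mathcal K$, $y_i^0=\nabla f_i(x_i^0)$; $\hat x_i^\nu=\arg\min_{x_i\in\mathcal K}\tilde f_i(x_i;x_i^\nu)+(y_i^\nu-\nabla f_i(x_i^\nu))^\top(x_i-x_i^\nu)+G(x_i)$; $x_i^{\nu+1/2}=x_i^\nu+\alpha(\hat x_i^\nu-x_i^\nu)$; $x_i^{\nu+1}=\sum_jw_{ij}x_j^{\nu+1/2}$; $y_i^{\nu+1}=\sum_jw_{ij}(y_j^\nu+\nabla f_j(x_j^{\nu+1})-\nabla f_j(x_j^\nu))$. *)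

theory Defs
  imports "HOL-Analysis.Analysis" "HOL-Library.Landau_Symbols"
begin

text \<open>c-strong convexity (c > 0): f - c/2 |.|^2 is convex on S.\<close>
definition strongly_convex_with :: "'a::real_inner set \<Rightarrow> ('a \<Rightarrow> real) \<Rightarrow> real \<Rightarrow> bool" where
  "strongly_convex_with S f c \<longleftrightarrow> convex_on S (\<lambda>x. f x - c / 2 * (norm x)\<^sup>2)"

text \<open>Twice continuously differentiable (C^2) on an open set S, via Frechet derivatives.\<close>
definition C2_on :: "'b::real_normed_vector set \<Rightarrow> ('b \<Rightarrow> real) \<Rightarrow> bool" where
  "C2_on S f \<longleftrightarrow> (\<exists>(f' :: 'b \<Rightarrow> ('b \<Rightarrow>\<^sub>L real)) (f'' :: 'b \<Rightarrow> ('b \<Rightarrow>\<^sub>L ('b \<Rightarrow>\<^sub>L real))).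
      (\<forall>x\<in>S. (f has_derivative blinfun_apply (f' x)) (at x)) \<and>
      (\<forall>x\<in>S. (f' has_derivative blinfun_apply (f'' x)) (at x)) \<and>
      continuous_on S f'')"

text \<open>Connected undirected graph on vertices {0..<m} with edge set E.\<close>
definition undirected_connected_graph :: "nat \<Rightarrow> (nat \<times> nat) set \<Rightarrow> bool" where
  "undirected_connected_graph m E \<longleftrightarrow>
     E \<subseteq> {..<m} \<times> {..<m} \<and> sym E \<and> (\<forall>i. (i, i) \<notin> E) \<and>
     (\<forall>i<m. \<forall>j<m. (i, j) \<in> E\<^sup>*)"

text \<open>Weight matrix assumption (W).\<close>
definition weights_ok :: "nat \<Rightarrow> (nat \<times> nat) set \<Rightarrow> (nat \<Rightarrow> nat \<Rightarrow> real) \<Rightarrow> bool" where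
  "weights_ok m E w \<longleftrightarrow>
     (\<forall>i<m. w i i > 0) \<and>
     (\<forall>i<m. \<forall>j<m. i \<noteq> j \<longrightarrow> (w i j > 0 \<longleftrightarrow> (i, j) \<in> E) \<and> ((i, j) \<notin> E \<longrightarrow> w i j = 0)) \<and>
     (\<forall>i<m. (\<Sum>j<m. w i j) = 1) \<and> (\<forall>j<m. (\<Sum>i<m. w i j) = 1)"

text \<open>Largest singular value (= spectral / operator 2-norm) of
  W \<otimes> I_d - (1/m) 1 1^T \<otimes> I_d, acting on stacked vectors (X_0,...,X_{m-1}) in 'a^m.\<close>
definition sonata_rho :: "'a::euclidean_space itself \<Rightarrow> nat \<Rightarrow> (nat \<Rightarrow> nat \<Rightarrow> real) \<Rightarrow> real" where
  "sonata_rho _ m w = Sup {sqrt (\<Sum>i<m. (norm (\<Sum>j<m. (w i j - 1 / real m) *\<^sub>R (X j :: 'a)))\<^sup>2) | X.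
       (\<Sum>i<m. (norm (X i))\<^sup>2) \<le> 1}"

definition GPstar :: "real \<Rightarrow> real \<Rightarrow> real \<Rightarrow> real \<Rightarrow> real \<Rightarrow> real" where
  "GPstar mu mut Dl Dmax a =
     (let q = (1 - a / 2) * mut + Dl / 2 * a in (Dmax\<^sup>2 / mu + (1 / mu) * q\<^sup>2) / q\<^sup>2)"

text \<open>abar = mut/(mut - Dl), +infinity if mut = Dl.\<close>
definition abar :: "real \<Rightarrow> real \<Rightarrow> ereal" where
  "abar mut Dl = (if mut = Dl then \<infinity> else ereal (mut / (mut - Dl)))"

text \<open>G_P^*(abar); when mut = Dl, G_P^* is constant in alpha and this is that constant.\<close>
definition GPbar :: "real \<Rightarrow> real \<Rightarrow> real \<Rightarrow> real \<Rightarrow> real" where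
  "GPbar mu mut Dl Dmax = (if mut = Dl then GPstar mu mut Dl Dmax 0 else GPstar mu mut Dl Dmax (mut / (mut - Dl)))"

definition sonata_C1 :: "real \<Rightarrow> real \<Rightarrow> real \<Rightarrow> real \<Rightarrow> real" where
  "sonata_C1 mu mut Dmax Lmax = 6 / mu * ((Dmax / mut + 1)\<^sup>2 + 4 * Lmax\<^sup>2 / mut\<^sup>2)"

definition sonata_C2 :: "real \<Rightarrow> real" where
  "sonata_C2 mut = 4 / mut\<^sup>2"

definition sonata_Ahalf :: "real \<Rightarrow> real \<Rightarrow> real \<Rightarrow> real \<Rightarrow> real \<Rightarrow> real \<Rightarrow> real" where
  "sonata_Ahalf mu mut Dl Dmax Lmax rho =
     (let G = GPbar mu mut Dl Dmax; C1 = sonata_C1 mu mut Dmax Lmax; C2 = sonata_C2 mut;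
          A1 = 2 * G * C1 * (4 * Lmax\<^sup>2 * rho\<^sup>2);
          A2 = (4 * G * C1 + C2) * (2 * Lmax\<^sup>2 * rho\<^sup>2);
          A3 = (4 * G * C1 + C2) * (8 * Lmax\<^sup>2 * rho ^ 4)
      in sqrt (A1 + A2 + A3))"

definition sonata_J :: "real \<Rightarrow> real \<Rightarrow> real \<Rightarrow> real" where
  "sonata_J mu mut Dmax = 1 / 2 * (mut * mu / (4 * Dmax\<^sup>2 + mut * mu))"

definition sonata_astar :: "real \<Rightarrow> real \<Rightarrow> real \<Rightarrow> real" where
  "sonata_astar Ah J rho = ((- rho * sqrt Ah + sqrt (Ah + J * (1 - rho\<^sup>2))) / (Ah + J))\<^sup>2"

text \<open>alpha_max = min{(1-rho)^2/A_half, abar, 1}, with (1-rho)^2/0 read as +infinity.\<close>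
definition sonata_amax :: "real \<Rightarrow> real \<Rightarrow> real \<Rightarrow> real \<Rightarrow> ereal" where
  "sonata_amax Ah rho mut Dl =
     min (if Ah = 0 then \<infinity> else ereal ((1 - rho)\<^sup>2 / Ah)) (min (abar mut Dl) 1)"

text \<open>Aggregated constants, from the problem data (indices 0..<m).\<close>
definition sonata_Dmax :: "nat \<Rightarrow> (nat \<Rightarrow> real) \<Rightarrow> (nat \<Rightarrow> real) \<Rightarrow> real" where
  "sonata_Dmax m Dl Du = Max ((\<lambda>i. max \<bar>Dl i\<bar> \<bar>Du i\<bar>) ` {..<m})"

definition sonata_Ah_of :: "nat \<Rightarrow> real \<Rightarrow> (nat \<Rightarrow> real) \<Rightarrow> (nat \<Rightarrow> real) \<Rightarrow> (nat \<Rightarrow> real) \<Rightarrow> (nat \<Rightarrow> real) \<Rightarrow> real \<Rightarrow> real" where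
  "sonata_Ah_of m mu mut Dl Du Li rho =
     sonata_Ahalf mu (Min (mut ` {..<m})) (Min (Dl ` {..<m})) (sonata_Dmax m Dl Du) (Max (Li ` {..<m})) rho"

definition sonata_J_of :: "nat \<Rightarrow> real \<Rightarrow> (nat \<Rightarrow> real) \<Rightarrow> (nat \<Rightarrow> real) \<Rightarrow> (nat \<Rightarrow> real) \<Rightarrow> real" where
  "sonata_J_of m mu mut Dl Du = sonata_J mu (Min (mut ` {..<m})) (sonata_Dmax m Dl Du)"

definition sonata_alpha_max :: "nat \<Rightarrow> real \<Rightarrow> (nat \<Rightarrow> real) \<Rightarrow> (nat \<Rightarrow> real) \<Rightarrow> (nat \<Rightarrow> real) \<Rightarrow> (nat \<Rightarrow> real) \<Rightarrow> real \<Rightarrow> ereal" where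
  "sonata_alpha_max m mu mut Dl Du Li rho =
     sonata_amax (sonata_Ah_of m mu mut Dl Du Li rho) rho (Min (mut ` {..<m})) (Min (Dl ` {..<m}))"

definition sonata_alpha_star :: "nat \<Rightarrow> real \<Rightarrow> (nat \<Rightarrow> real) \<Rightarrow> (nat \<Rightarrow> real) \<Rightarrow> (nat \<Rightarrow> real) \<Rightarrow> (nat \<Rightarrow> real) \<Rightarrow> real \<Rightarrow> real" where
  "sonata_alpha_star m mu mut Dl Du Li rho =
     sonata_astar (sonata_Ah_of m mu mut Dl Du Li rho) (sonata_J_of m mu mut Dl Du) rho"

text \<open>The rate z of Theorem 3.10.\<close>
definition sonata_z :: "nat \<Rightarrow> real \<Rightarrow> (nat \<Rightarrow> real) \<Rightarrow> (nat \<Rightarrow> real) \<Rightarrow> (nat \<Rightarrow> real) \<Rightarrow> (nat \<Rightarrow> real) \<Rightarrow> real \<Rightarrow> real \<Rightarrow> real" where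
  "sonata_z m mu mut Dl Du Li rho a =
     (if ereal a < min (ereal (sonata_alpha_star m mu mut Dl Du Li rho)) (sonata_alpha_max m mu mut Dl Du Li rho)
      then 1 - sonata_J_of m mu mut Dl Du * a
      else (rho + sqrt (a * sonata_Ah_of m mu mut Dl Du Li rho))\<^sup>2)"

end

theory Submission
  imports Defs
begin

text \<open>One local step contracts the optimality gap \<open>p\<close> (the sum over the agents of \<open>U x\<^sub>i - U*\<close>) up to the
  gradient-tracking error: a convex combination of a descent estimate for the damped step and a bound on the
  gap at the surrogate minimiser eliminates the step length. The tracking error is controlled by the consensus
  errors of \<open>x\<close> and \<open>y\<close>, which the mixing step contracts by \<open>\<rho>\<close> up to multiples of \<open>\<alpha> d\<close>, and the total step
  length \<open>d\<close> is in turn bounded by \<open>p\<close> and the consensus error of \<open>y\<close>. Weighting all four sequences by powers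
  of \<open>sqrt z\<close> closes the loop with gain at most \<open>(A1 s\<^sup>2 + A2 s\<^sup>2 + A3) \<alpha>\<^sup>2 / s\<^sup>4\<close>, where \<open>s = sqrt z - \<rho>\<close>; this is
  below 1 because \<open>s < 1\<close> and \<open>\<alpha> A\<^sub>1\<^sub>/\<^sub>2 \<le> s\<^sup>2\<close>.\<close>

subsection \<open>Gradients and Hessians on a convex set\<close>

text \<open>Two features of the data shape the argument. The Hessians of the \<open>f i\<close>
  merely exist, without continuity, and the curvature bounds concern only the quadratic forms
  \<open>h \<bullet> H h\<close>. Lipschitz constants of gradients need operator norms, so symmetry
  of the second derivative is established first, by second differences. Moreover G is convex but
  possibly not lower semicontinuous on K, so it enters only through chord inequalities and affine
  minorants, which survive a limit along a minimising sequence.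

  The constants have these origins. The curvature of the damped step decreases linearly in \<alpha>,
  from \<open>mt\<close> down to \<open>mt / 2\<close> at \<open>abar\<close>, and
  \<open>GPbar\<close> is evaluated at that worst case. J is half of a lower bound on the local
  contraction; the other half separates z from the local contraction factor, so the tracking error
  is amplified by at most twice \<open>GPbar\<close>. Strict contraction of the consensus errors is
  read off the step-size bound, which keeps \<open>\<rho> + sqrt (\<alpha> * Ah)\<close> below
  1.\<close>

lemma has_derivative_along_line:
  fixes g :: "'a::real_inner \<Rightarrow> real"
  assumes "(g has_derivative (\<lambda>h. gg \<bullet> h)) (at (a + t *\<^sub>R d))"
  shows "((\<lambda>t. g (a + t *\<^sub>R d)) has_real_derivative gg \<bullet> d) (at t)"
proof -
  have "((\<lambda>t. a + t *\<^sub>R d) has_derivative (\<lambda>s. s *\<^sub>R d)) (at t)"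
    by (auto intro!: derivative_eq_intros)
  from has_derivative_compose[OF this assms]
  have "((\<lambda>t. g (a + t *\<^sub>R d)) has_derivative (\<lambda>s. gg \<bullet> (s *\<^sub>R d))) (at t)" .
  then show ?thesis
    unfolding has_field_derivative_def by (simp add: mult.commute[of _ "gg \<bullet> d"])
qed

lemma gradient_along_line:
  fixes gg :: "'a::real_inner \<Rightarrow> 'a"
  assumes "(gg has_derivative H) (at (a + t *\<^sub>R d))"
  shows "((\<lambda>t. gg (a + t *\<^sub>R d) \<bullet> e) has_real_derivative H d \<bullet> e) (at t)"
proof -
  interpret H: bounded_linear H using assms by (rule has_derivative_bounded_linear)
  have "((\<lambda>t. a + t *\<^sub>R d) has_derivative (\<lambda>s. s *\<^sub>R d)) (at t)"
    by (auto intro!: derivative_eq_intros)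
  from has_derivative_inner_left[OF has_derivative_compose[OF this assms]]
  have "((\<lambda>t. gg (a + t *\<^sub>R d) \<bullet> e) has_derivative (\<lambda>s. H (s *\<^sub>R d) \<bullet> e)) (at t)" .
  then show ?thesis
    unfolding has_field_derivative_def by (simp add: H.scaleR mult.commute[of _ "H d \<bullet> e"])
qed

section \<open>Symmetry of second derivatives and operator-norm bounds\<close>

lemma second_difference_approx:
  fixes g :: "'a::real_inner \<Rightarrow> real"
  assumes S: "open S" "z \<in> S"
    and g: "\<And>s. s \<in> S \<Longrightarrow> (g has_derivative (\<lambda>h. gg s \<bullet> h)) (at s)"
    and H: "(gg has_derivative H) (at z)"
    and e: "e > 0"
  shows "\<exists>t0>0. \<forall>t. 0 < t \<and> t < t0 \<longrightarrow>
    \<bar>g (z + t *\<^sub>R u + t *\<^sub>R v) - g (z + t *\<^sub>R u) - g (z + t *\<^sub>R v) + g z - t\<^sup>2 * (u \<bullet> H v)\<bar> \<le> e * t\<^sup>2"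
proof -
  define M where "M = norm u + norm v + 1"
  have M: "M > 0" unfolding M_def by (smt (verit) norm_ge_zero)
  \<comment> \<open>The two linearisation errors of the gradient are at most
    \<open>e' * (t * M)\<close> each; multiplied by \<open>t\<close> and by \<open>norm u\<close>,
    which is at most \<open>M\<close>, they add up to \<open>e * t\<^sup>2\<close>.\<close>
  define e' where "e' = e / (2 * M\<^sup>2)"
  have e': "e' > 0" using e M by (simp add: e'_def)
  interpret H: bounded_linear H using H by (rule has_derivative_bounded_linear)
  obtain d1 where d1: "d1 > 0" "ball z d1 \<subseteq> S"
    using S openE by blast
  obtain d2 where d2: "d2 > 0"
    "\<And>y. norm (y - z) < d2 \<Longrightarrow> norm (gg y - gg z - H (y - z)) \<le> e' * norm (y - z)"
    using H e' unfolding has_derivative_at_alt by blast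
  define t0 where "t0 = min d1 d2 / M"
  have t0: "t0 > 0" using d1 d2 M by (simp add: t0_def)
  show ?thesis
  proof (intro exI[of _ t0] conjI allI impI t0)
    fix t :: real assume t: "0 < t \<and> t < t0"
    have tM: "t * M < d1" "t * M < d2"
      using t M by (auto simp: t0_def pos_less_divide_eq)
    have small: "norm (s *\<^sub>R (t *\<^sub>R u) + r *\<^sub>R (t *\<^sub>R v)) \<le> t * M"
      if "0 \<le> s" "s \<le> 1" "0 \<le> r" "r \<le> 1" for s r
    proof -
      have "norm (s *\<^sub>R (t *\<^sub>R u) + r *\<^sub>R (t *\<^sub>R v)) \<le> s * (t * norm u) + r * (t * norm v)"
        using norm_triangle_ineq[of "s *\<^sub>R (t *\<^sub>R u)" "r *\<^sub>R (t *\<^sub>R v)"] that t by simp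
      also have "\<dots> \<le> t * norm u + t * norm v"
        using that t by (intro add_mono mult_left_le_one_le) auto
      also have "\<dots> \<le> t * M" using t by (simp add: M_def distrib_left)
      finally show ?thesis .
    qed
    \<comment> \<open>The mean value theorem runs in direction u on the difference of
      \<open>g\<close> across \<open>t *\<^sub>R v\<close>. Differentiability of \<open>gg\<close>
      at the single point \<open>z\<close> then compares both gradients with H.\<close>
    define \<phi> where "\<phi> s = g ((z + t *\<^sub>R v) + s *\<^sub>R (t *\<^sub>R u)) - g (z + s *\<^sub>R (t *\<^sub>R u))" for s
    define \<phi>' where "\<phi>' s = gg ((z + t *\<^sub>R v) + s *\<^sub>R (t *\<^sub>R u)) \<bullet> (t *\<^sub>R u) - gg (z + s *\<^sub>R (t *\<^sub>R u)) \<bullet> (t *\<^sub>R u)" for s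
    have inS: "z + s *\<^sub>R (t *\<^sub>R u) + r *\<^sub>R (t *\<^sub>R v) \<in> S" if "0 \<le> s" "s \<le> 1" "0 \<le> r" "r \<le> 1" for s r
    proof -
      have "dist z (z + s *\<^sub>R (t *\<^sub>R u) + r *\<^sub>R (t *\<^sub>R v)) < d1"
        using small[OF that] tM
        by (simp only: dist_norm norm_minus_commute[of z] add.assoc add_diff_cancel_left')
      then show ?thesis using d1(2) by auto
    qed
    have der: "(\<phi> has_real_derivative \<phi>' s) (at s)" if "0 \<le> s" "s \<le> 1" for s
      unfolding \<phi>_def \<phi>'_def
      using inS[OF that, of 1] inS[OF that, of 0]
      by (intro DERIV_diff has_derivative_along_line g) (simp_all add: algebra_simps)
    obtain s where s: "0 < s" "s < 1" "\<phi> 1 - \<phi> 0 = (1 - 0) * \<phi>' s"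
      using MVT2[of 0 1 \<phi> \<phi>'] der by force
    define p where "p = s *\<^sub>R (t *\<^sub>R u) + t *\<^sub>R v"
    define q where "q = s *\<^sub>R (t *\<^sub>R u)"
    have np: "norm p \<le> t * M" and nq: "norm q \<le> t * M"
      using small[of s 1] small[of s 0] s by (auto simp: p_def q_def)
    have p: "norm (gg (z + p) - gg z - H p) \<le> e' * (t * M)"
      using d2(2)[of "z + p"] np tM mult_left_mono[OF np less_imp_le[OF e']] by simp
    have q: "norm (gg (z + q) - gg z - H q) \<le> e' * (t * M)"
      using d2(2)[of "z + q"] nq tM mult_left_mono[OF nq less_imp_le[OF e']] by simp
    have Hpq: "H p - H q = t *\<^sub>R H v"
      by (simp add: p_def q_def H.add H.scaleR)
    have eq: "gg (z + p) - gg (z + q) - t *\<^sub>R H v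
        = (gg (z + p) - gg z - H p) - (gg (z + q) - gg z - H q)"
      unfolding Hpq[symmetric] by simp
    have le: "norm (gg (z + p) - gg (z + q) - t *\<^sub>R H v) \<le> 2 * (e' * (t * M))"
      unfolding eq using norm_triangle_ineq4[of "gg (z + p) - gg z - H p" "gg (z + q) - gg z - H q"] p q by linarith
    have "\<phi> 1 - \<phi> 0 - t\<^sup>2 * (u \<bullet> H v) = t * ((gg (z + p) - gg (z + q) - t *\<^sub>R H v) \<bullet> u)"
      unfolding s \<phi>'_def p_def q_def
      by (simp add: algebra_simps inner_diff_left power2_eq_square inner_commute)
    then have "\<bar>\<phi> 1 - \<phi> 0 - t\<^sup>2 * (u \<bullet> H v)\<bar> \<le> t * (norm (gg (z + p) - gg (z + q) - t *\<^sub>R H v) * norm u)"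
      using t Cauchy_Schwarz_ineq2[of "gg (z + p) - gg (z + q) - t *\<^sub>R H v" u]
      by (simp add: abs_mult)
    also have "\<dots> \<le> t * (2 * (e' * (t * M)) * M)"
      using t e' M le by (intro mult_left_mono mult_mono) (auto simp: M_def)
    also have "\<dots> = e * t\<^sup>2" using M by (simp add: e'_def power2_eq_square)
    finally show "\<bar>g (z + t *\<^sub>R u + t *\<^sub>R v) - g (z + t *\<^sub>R u) - g (z + t *\<^sub>R v) + g z - t\<^sup>2 * (u \<bullet> H v)\<bar> \<le> e * t\<^sup>2"
      by (simp add: \<phi>_def algebra_simps)
  qed
qed

text \<open>The second difference is unchanged when u and v are swapped, so both values of the form
  approximate the same number after division by \<open>t\<^sup>2\<close>.\<close>

lemma second_derivative_symmetric:
  fixes g :: "'a::real_inner \<Rightarrow> real"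
  assumes S: "open S" "z \<in> S"
    and g: "\<And>s. s \<in> S \<Longrightarrow> (g has_derivative (\<lambda>h. gg s \<bullet> h)) (at s)"
    and H: "(gg has_derivative H) (at z)"
  shows "u \<bullet> H v = v \<bullet> H u"
proof -
  have "\<bar>u \<bullet> H v - v \<bullet> H u\<bar> \<le> e" if "e > 0" for e
  proof -
    have e2: "e / 2 > 0" using that by simp
    obtain t1 where t1: "t1 > 0" "\<And>t. 0 < t \<Longrightarrow> t < t1 \<Longrightarrow>
      \<bar>g (z + t *\<^sub>R u + t *\<^sub>R v) - g (z + t *\<^sub>R u) - g (z + t *\<^sub>R v) + g z - t\<^sup>2 * (u \<bullet> H v)\<bar> \<le> e / 2 * t\<^sup>2"
      using second_difference_approx[OF S g H e2] by blast
    obtain t2 where t2: "t2 > 0" "\<And>t. 0 < t \<Longrightarrow> t < t2 \<Longrightarrow>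
      \<bar>g (z + t *\<^sub>R v + t *\<^sub>R u) - g (z + t *\<^sub>R v) - g (z + t *\<^sub>R u) + g z - t\<^sup>2 * (v \<bullet> H u)\<bar> \<le> e / 2 * t\<^sup>2"
      using second_difference_approx[OF S g H e2] by blast
    define t where "t = min t1 t2 / 2"
    have t: "0 < t" "t < t1" "t < t2" using t1 t2 by (auto simp: t_def)
    have sw: "z + t *\<^sub>R v + t *\<^sub>R u = z + t *\<^sub>R u + t *\<^sub>R v" by simp
    have "\<bar>t\<^sup>2 * (u \<bullet> H v) - t\<^sup>2 * (v \<bullet> H u)\<bar> \<le> e * t\<^sup>2"
      using t1(2)[OF t(1,2)] t2(2)[OF t(1,3)] unfolding sw by linarith
    then have "t\<^sup>2 * \<bar>u \<bullet> H v - v \<bullet> H u\<bar> \<le> t\<^sup>2 * e"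
      by (simp only: right_diff_distrib[symmetric] abs_mult) (simp add: mult.commute)
    then show ?thesis using t(1) by simp
  qed
  then have "\<bar>u \<bullet> H v - v \<bullet> H u\<bar> \<le> 0" by (rule field_le_epsilon) (simp_all)
  then show ?thesis by simp
qed

text \<open>Polarisation: symmetry expresses \<open>u \<bullet> H v\<close> by the form at u + v and
  u - v, and the parallelogram law bounds it. The optimal u points along \<open>H v\<close> and is
  scaled to the length of v.\<close>

lemma symmetric_form_bound:
  fixes H :: "'a::real_inner \<Rightarrow> 'a"
  assumes lin: "linear H" and sym: "\<And>u v. u \<bullet> H v = v \<bullet> H u"
    and bd: "\<And>h. \<bar>h \<bullet> H h\<bar> \<le> D * (norm h)\<^sup>2"
  shows "norm (H v) \<le> D * norm v"
proof -
  have pol: "4 * (u \<bullet> H v) \<le> 2 * D * ((norm u)\<^sup>2 + (norm v)\<^sup>2)" for u v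
  proof -
    have "4 * (u \<bullet> H v) = (u + v) \<bullet> H (u + v) - (u - v) \<bullet> H (u - v)"
      using sym[of u v] by (simp add: linear_add[OF lin] linear_diff[OF lin] inner_simps)
    also have "\<dots> \<le> D * (norm (u + v))\<^sup>2 + D * (norm (u - v))\<^sup>2"
      using bd[of "u + v"] bd[of "u - v"] by linarith
    also have "\<dots> = 2 * D * ((norm u)\<^sup>2 + (norm v)\<^sup>2)"
      by (simp add: power2_norm_eq_inner inner_simps algebra_simps)
    finally show ?thesis .
  qed
  show ?thesis
  proof (cases "v = 0 \<or> H v = 0")
    case True
    moreover have "0 \<le> D * norm v" if "v \<noteq> 0"
    proof -
      have "0 \<le> D * (norm v)\<^sup>2" using bd[of v] by linarith
      then show ?thesis using that by (simp add: zero_le_mult_iff)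
    qed
    ultimately show ?thesis using linear_0[OF lin] by fastforce
  next
    case False
    define u where "u = (norm v / norm (H v)) *\<^sub>R H v"
    have nu: "norm u = norm v" using False by (simp add: u_def)
    have "u \<bullet> H v = norm v * norm (H v)"
      using False by (simp add: u_def power2_norm_eq_inner[symmetric] power2_eq_square)
    then have "norm v * norm (H v) \<le> norm v * (D * norm v)"
      using pol[of u v] by (simp add: nu power2_eq_square algebra_simps)
    then show ?thesis using False by simp
  qed
qed

text \<open>Symmetry turns the bound on the form into a bound on the operator norm, to which the
  mean value inequality on the convex set applies.\<close>

lemma gradient_lipschitz_of_hessian_bound:
  fixes g :: "'a::euclidean_space \<Rightarrow> real"
  assumes S: "open S" "K \<subseteq> S" and K: "convex K"
    and g: "\<And>s. s \<in> S \<Longrightarrow> (g has_derivative (\<lambda>h. gg s \<bullet> h)) (at s)"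
    and H: "\<And>s. s \<in> K \<Longrightarrow> (gg has_derivative H s) (at s)"
    and bd: "\<And>s h. s \<in> K \<Longrightarrow> \<bar>h \<bullet> H s h\<bar> \<le> D * (norm h)\<^sup>2"
    and ab: "a \<in> K" "b \<in> K"
  shows "norm (gg b - gg a) \<le> D * norm (b - a)"
proof (rule differentiable_bound[OF K _ _ ab(2,1)])
  show "(gg has_derivative H s) (at s within K)" if "s \<in> K" for s
    using H[OF that] by (rule has_derivative_at_withinI)
  show "onorm (H s) \<le> D" if "s \<in> K" for s
  proof (rule onorm_le)
    have "linear (H s)" using H[OF that] by (simp add: has_derivative_bounded_linear bounded_linear.linear)
    moreover have "u \<bullet> H s v = v \<bullet> H s u" for u v
      using second_derivative_symmetric[OF S(1) _ g H[OF that]] that S by blast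
    ultimately show "norm (H s v) \<le> D * norm v" for v
      using bd[OF that] by (rule symmetric_form_bound)
  qed
qed

section \<open>Lower curvature bounds and first-order conditions\<close>

lemma gradient_strongly_monotone:
  fixes gg :: "'a::real_inner \<Rightarrow> 'a"
  assumes K: "convex K"
    and H: "\<And>s. s \<in> K \<Longrightarrow> (gg has_derivative H s) (at s)"
    and bd: "\<And>s h. s \<in> K \<Longrightarrow> c * (norm h)\<^sup>2 \<le> h \<bullet> H s h"
    and ab: "a \<in> K" "b \<in> K"
  shows "c * (norm (b - a))\<^sup>2 \<le> (gg b - gg a) \<bullet> (b - a)"
proof -
  define d where "d = b - a"
  have inK: "a + t *\<^sub>R d \<in> K" if "0 \<le> t" "t \<le> 1" for t
  proof -
    have "(1 - t) *\<^sub>R a + t *\<^sub>R b \<in> K" using K ab that by (intro convexD) auto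
    then show ?thesis by (simp add: d_def algebra_simps)
  qed
  have "\<exists>t. 0 < t \<and> t < 1 \<and> gg (a + 1 *\<^sub>R d) \<bullet> d - gg (a + 0 *\<^sub>R d) \<bullet> d = (1 - 0) * (H (a + t *\<^sub>R d) d \<bullet> d)"
    by (rule MVT2[where f = "\<lambda>t. gg (a + t *\<^sub>R d) \<bullet> d"]) (simp_all add: gradient_along_line H inK)
  then obtain t where t: "0 < t" "t < 1" "gg (a + d) \<bullet> d - gg a \<bullet> d = H (a + t *\<^sub>R d) d \<bullet> d"
    by auto
  have "c * (norm d)\<^sup>2 \<le> gg (a + d) \<bullet> d - gg a \<bullet> d"
    using bd[OF inK[of t], of d] t by (simp add: inner_commute)
  then show ?thesis by (simp add: d_def inner_diff_left)
qed

text \<open>Along the segment, \<open>g\<close> minus its linearisation and minus the quadratic has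
  nonnegative derivative. The sign of \<open>c\<close> is free: the result also serves the
  difference of surrogate and objective, whose lower curvature bound may be negative.\<close>

lemma strongly_convex_lower_bound:
  fixes g :: "'a::real_inner \<Rightarrow> real"
  assumes K: "convex K"
    and g: "\<And>s. s \<in> K \<Longrightarrow> (g has_derivative (\<lambda>h. gg s \<bullet> h)) (at s)"
    and mono: "\<And>a b. a \<in> K \<Longrightarrow> b \<in> K \<Longrightarrow> c * (norm (b - a))\<^sup>2 \<le> (gg b - gg a) \<bullet> (b - a)"
    and ab: "a \<in> K" "b \<in> K"
  shows "g a + gg a \<bullet> (b - a) + c / 2 * (norm (b - a))\<^sup>2 \<le> g b"
proof -
  define d where "d = b - a"
  have inK: "a + t *\<^sub>R d \<in> K" if "0 \<le> t" "t \<le> 1" for t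
  proof -
    have "(1 - t) *\<^sub>R a + t *\<^sub>R b \<in> K" using K ab that by (intro convexD) auto
    then show ?thesis by (simp add: d_def algebra_simps)
  qed
  define \<psi> where "\<psi> t = g (a + t *\<^sub>R d) - t * (gg a \<bullet> d) - c / 2 * t\<^sup>2 * (norm d)\<^sup>2" for t
  have "\<psi> 0 \<le> \<psi> 1"
  proof (rule DERIV_nonneg_imp_nondecreasing[where f = \<psi> and a = 0 and b = 1])
    fix t :: real assume t: "0 \<le> t" "t \<le> 1"
    have "(\<psi> has_real_derivative (gg (a + t *\<^sub>R d) \<bullet> d - gg a \<bullet> d - c * t * (norm d)\<^sup>2)) (at t)"
      unfolding \<psi>_def
      by (rule derivative_eq_intros refl has_derivative_along_line g inK t)+ simp
    moreover have "0 \<le> gg (a + t *\<^sub>R d) \<bullet> d - gg a \<bullet> d - c * t * (norm d)\<^sup>2"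
    proof (cases "t = 0")
      case False
      then have t0: "t > 0" using t by simp
      have "t * (c * t * (norm d)\<^sup>2) \<le> t * ((gg (a + t *\<^sub>R d) - gg a) \<bullet> d)"
        using mono[OF ab(1) inK[OF t]] by (simp add: power_mult_distrib power2_eq_square mult_ac)
      then show ?thesis using t0 by (simp add: inner_diff_left)
    qed simp
    ultimately show "\<exists>y. DERIV \<psi> t :> y \<and> 0 \<le> y" by blast
  qed simp
  then show ?thesis by (simp add: \<psi>_def d_def)
qed

text \<open>Here \<open>g\<close> is the smooth part of an objective and \<open>e\<close> the
  increment of the convex part along the whole segment. Convexity bounds the latter's change by
  \<open>t * e\<close>, so no derivative or subgradient of the convex part is required.\<close>

lemma directional_optimality:
  fixes g :: "'a::real_inner \<Rightarrow> real"
  assumes g: "(g has_derivative (\<lambda>h. gg \<bullet> h)) (at a)"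
    and pos: "\<And>t. 0 < t \<Longrightarrow> t < 1 \<Longrightarrow> 0 \<le> g (a + t *\<^sub>R d) - g a + t * e"
  shows "0 \<le> gg \<bullet> d + e"
proof -
  have "((\<lambda>t. g (a + t *\<^sub>R d)) has_real_derivative gg \<bullet> d) (at 0)"
    by (rule has_derivative_along_line) (simp add: g)
  then have "((\<lambda>t. (g (a + t *\<^sub>R d) - g a) / t) \<longlongrightarrow> gg \<bullet> d) (at_right 0)"
    unfolding has_field_derivative_iff by (simp add: filterlim_at_split)
  then have "((\<lambda>t. (g (a + t *\<^sub>R d) - g a) / t + e) \<longlongrightarrow> gg \<bullet> d + e) (at_right 0)"
    by (intro tendsto_intros)
  moreover have "eventually (\<lambda>t. 0 \<le> (g (a + t *\<^sub>R d) - g a) / t + e) (at_right (0::real))"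
    unfolding eventually_at_right_field
  proof (intro exI[of _ 1] conjI allI impI)
    fix t :: real assume t: "0 < t" "t < 1"
    have "0 \<le> (g (a + t *\<^sub>R d) - g a + t * e) / t" using pos[OF t] t by simp
    also have "\<dots> = (g (a + t *\<^sub>R d) - g a) / t + e" using t by (simp add: field_simps)
    finally show "0 \<le> (g (a + t *\<^sub>R d) - g a) / t + e" .
  qed simp
  ultimately show ?thesis by (rule tendsto_lowerbound) simp
qed

lemma convex_gradient_inequality:
  fixes g :: "'a::real_inner \<Rightarrow> real"
  assumes K: "convex_on K g" and ab: "a \<in> K" "b \<in> K"
    and g: "(g has_derivative (\<lambda>h. gg \<bullet> h)) (at a)"
  shows "g a + gg \<bullet> (b - a) \<le> g b"
proof -
  \<comment> \<open>With the smooth part \<open>- g\<close>, the hypothesis of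
    \<open>directional_optimality\<close> becomes the chord inequality of the convex function
    \<open>g\<close>.\<close>
  have "0 \<le> (- gg) \<bullet> (b - a) + (g b - g a)"
  proof (rule directional_optimality[where g = "\<lambda>s. - g s" and a = a])
    show "((\<lambda>s. - g s) has_derivative (\<lambda>h. (- gg) \<bullet> h)) (at a)"
      using has_derivative_minus[OF g] by simp
    fix t :: real assume t: "0 < t" "t < 1"
    have "g (a + t *\<^sub>R (b - a)) \<le> (1 - t) * g a + t * g b"
      using convex_onD[OF K, of t a b] t ab by (simp add: algebra_simps)
    then show "0 \<le> - g (a + t *\<^sub>R (b - a)) - - g a + t * (g b - g a)"
      by (simp add: algebra_simps)
  qed
  then show ?thesis by simp
qed

lemma strongly_convex_with_gradient_inequality:
  fixes g :: "'a::real_inner \<Rightarrow> real"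
  assumes K: "strongly_convex_with K g c" and ab: "a \<in> K" "b \<in> K"
    and g: "(g has_derivative (\<lambda>h. gg \<bullet> h)) (at a)"
  shows "g a + gg \<bullet> (b - a) + c / 2 * (norm (b - a))\<^sup>2 \<le> g b"
proof -
  have "((\<lambda>x. g x - c / 2 * (x \<bullet> x)) has_derivative (\<lambda>h. (gg - c *\<^sub>R a) \<bullet> h)) (at a)"
    by (rule derivative_eq_intros g refl)+ (auto simp: algebra_simps inner_commute)
  from convex_gradient_inequality[OF K[unfolded strongly_convex_with_def power2_norm_eq_inner] ab this]
  show ?thesis
    by (simp add: power2_norm_eq_inner inner_simps inner_commute algebra_simps)
qed

text \<open>Adding the gradient inequalities between z and a nearby point shows that the gradient is
  monotone along h, so its difference quotients are nonnegative. This supplies the lower half of the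
  two-sided Hessian bound for each \<open>f i\<close>.\<close>

lemma convex_hessian_nonneg:
  fixes g :: "'a::real_inner \<Rightarrow> real"
  assumes S: "open S" "z \<in> S" and conv: "convex_on S g"
    and g: "\<And>s. s \<in> S \<Longrightarrow> (g has_derivative (\<lambda>h. gg s \<bullet> h)) (at s)"
    and H: "(gg has_derivative H) (at z)"
  shows "0 \<le> h \<bullet> H h"
proof -
  have "((\<lambda>t. gg (z + t *\<^sub>R h) \<bullet> h) has_real_derivative H h \<bullet> h) (at 0)"
    by (rule gradient_along_line) (simp add: H)
  then have lim: "((\<lambda>t. (gg (z + t *\<^sub>R h) \<bullet> h - gg z \<bullet> h) / t) \<longlongrightarrow> H h \<bullet> h) (at_right 0)"
    unfolding has_field_derivative_iff by (simp add: filterlim_at_split)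
  have "eventually (\<lambda>t. z + t *\<^sub>R h \<in> S) (at_right (0::real))"
    using S by (intro topological_tendstoD[where S = S] tendsto_eq_intros) auto
  then have "eventually (\<lambda>t. 0 \<le> (gg (z + t *\<^sub>R h) \<bullet> h - gg z \<bullet> h) / t) (at_right 0)"
    using eventually_at_right_less[of 0]
  proof eventually_elim
    case (elim t)
    have "g z + gg z \<bullet> (t *\<^sub>R h) \<le> g (z + t *\<^sub>R h)"
      "g (z + t *\<^sub>R h) + gg (z + t *\<^sub>R h) \<bullet> (- (t *\<^sub>R h)) \<le> g z"
      using convex_gradient_inequality[OF conv S(2) elim(1) g[OF S(2)]]
        convex_gradient_inequality[OF conv elim(1) S(2) g[OF elim(1)]] by simp_all
    then have "0 \<le> t * (gg (z + t *\<^sub>R h) \<bullet> h - gg z \<bullet> h)" by (simp add: algebra_simps)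
    then show ?case using elim(2) by (simp add: zero_le_mult_iff)
  qed
  with lim have "0 \<le> H h \<bullet> h" by (intro tendsto_lowerbound) auto
  then show ?thesis by (simp add: inner_commute)
qed

subsection \<open>The surrogate step of one agent\<close>

text \<open>Strong convexity makes a minimising sequence Cauchy, with limit \<open>xs\<close>;
  \<open>c\<close> is the limit of G along it and may lie strictly below \<open>G xs\<close>. The
  last two conclusions are what a minimiser would provide: affine minorants of G remain valid at the
  pair, and the first-order condition holds with \<open>c\<close> as the value of G.\<close>

lemma composite_infimum_point:
  fixes F G :: "'a::euclidean_space \<Rightarrow> real" and K :: "'a set"
  defines "Us \<equiv> Inf ((\<lambda>s. F s + G s) ` K)"
  assumes K: "K \<noteq> {}" "closed K" and mu: "mu > 0"
    and dF: "\<And>s. s \<in> K \<Longrightarrow> (F has_derivative (\<lambda>h. gF s \<bullet> h)) (at s)"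
    and Fsc: "\<And>a b. a \<in> K \<Longrightarrow> b \<in> K \<Longrightarrow> F a + gF a \<bullet> (b - a) + mu / 2 * (norm (b - a))\<^sup>2 \<le> F b"
    and G: "convex_on K G"
    and bdd: "bdd_below ((\<lambda>s. F s + G s) ` K)"
  obtains xs c where "xs \<in> K" "F xs + c = Us"
    "\<forall>b g. (\<forall>v\<in>K. b \<le> G v + g \<bullet> v) \<longrightarrow> b \<le> c + g \<bullet> xs"
    "\<forall>v\<in>K. 0 \<le> gF xs \<bullet> (v - xs) + (G v - c)"
proof -
  have cK: "convex K" using G by (simp add: convex_on_def)
  have lower: "Us \<le> F s + G s" if "s \<in> K" for s
    unfolding Us_def using that bdd by (intro cInf_lower) auto
  have "\<exists>s\<in>K. F s + G s < Us + 1 / real (Suc n)" for n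
  proof -
    have "\<exists>r\<in>(\<lambda>s. F s + G s) ` K. r < Us + 1 / real (Suc n)"
      using cInf_lessD[of "(\<lambda>s. F s + G s) ` K" "Us + 1 / real (Suc n)"] K by (simp add: Us_def)
    then show ?thesis by blast
  qed
  then obtain u where u: "\<And>n. u n \<in> K" "\<And>n. F (u n) + G (u n) < Us + 1 / real (Suc n)"
    by metis
  \<comment> \<open>Strong convexity is expanded at the midpoint towards both ends; the linear terms
    cancel, and \<open>Us\<close> bounds the midpoint value from below.\<close>
  have mid: "mu / 8 * (norm (a - b))\<^sup>2 \<le> ((F a + G a) + (F b + G b)) / 2 - Us"
    if ab: "a \<in> K" "b \<in> K" for a b
  proof -
    define s where "s = (1 - 1 / 2) *\<^sub>R a + (1 / 2 :: real) *\<^sub>R b"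
    have s: "s \<in> K" unfolding s_def using cK ab by (intro convexD) auto
    have as: "a - s = (1 / 2) *\<^sub>R (a - b)" and bs: "b - s = - ((1 / 2) *\<^sub>R (a - b))"
      by (simp_all add: s_def algebra_simps flip: scaleR_add_left)
    have "F s + gF s \<bullet> (a - s) + mu / 8 * (norm (a - b))\<^sup>2 \<le> F a"
      "F s + gF s \<bullet> (b - s) + mu / 8 * (norm (a - b))\<^sup>2 \<le> F b"
      using Fsc[OF s ab(1)] Fsc[OF s ab(2)] by (simp_all add: as bs power_divide)
    moreover have "gF s \<bullet> (a - s) + gF s \<bullet> (b - s) = 0" by (simp add: as bs)
    moreover have "G s \<le> (1 - 1 / 2) * G a + 1 / 2 * G b"
      unfolding s_def using ab by (intro convex_onD[OF G]) auto
    ultimately show ?thesis using lower[OF s] by (simp add: field_simps)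
  qed
  have "Cauchy u"
  proof (rule metric_CauchyI)
    fix e :: real assume e: "e > 0"
    have "mu / 8 * e\<^sup>2 > 0" using mu e by simp
    then obtain N where N: "1 / real (Suc N) < mu / 8 * e\<^sup>2"
      using nat_approx_posE by blast
    have small: "F (u n) + G (u n) < Us + mu / 8 * e\<^sup>2" if "n \<ge> N" for n
    proof -
      have "1 / real (Suc n) \<le> 1 / real (Suc N)" using that by (simp add: frac_le)
      then show ?thesis using u(2)[of n] N by linarith
    qed
    have "dist (u n) (u k) < e" if "n \<ge> N" "k \<ge> N" for n k
    proof -
      have "mu / 8 * (norm (u n - u k))\<^sup>2 < mu / 8 * e\<^sup>2"
        by (rule le_less_trans[OF mid[OF u(1)[of n] u(1)[of k]]])
          (use small[OF that(1)] small[OF that(2)] in argo)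
      then have "(norm (u n - u k))\<^sup>2 < e\<^sup>2" using mu by simp
      then show ?thesis using e by (simp add: dist_norm power2_less_imp_less)
    qed
    then show "\<exists>N. \<forall>n\<ge>N. \<forall>k\<ge>N. dist (u n) (u k) < e" by blast
  qed
  then obtain xs where xs: "u \<longlonglongrightarrow> xs"
    using Cauchy_convergent convergent_def by blast
  have xsK: "xs \<in> K" using closed_sequentially[OF K(2) u(1) xs] .
  have contF: "isCont F s" if "s \<in> K" for s
    using dF[OF that] by (rule has_derivative_continuous)
  define c where "c = Us - F xs"
  have limU: "(\<lambda>n. F (u n) + G (u n)) \<longlonglongrightarrow> Us"
  proof (rule tendsto_sandwich[of "\<lambda>_. Us" _ _ "\<lambda>n. Us + 1 / real (Suc n)"])
    show "(\<lambda>n. Us + 1 / real (Suc n)) \<longlonglongrightarrow> Us"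
      using tendsto_add[OF tendsto_const[of Us] LIMSEQ_Suc[OF lim_1_over_n]] by simp
  qed (use lower u in \<open>auto intro!: always_eventually less_imp_le\<close>)
  have "(\<lambda>n. F (u n)) \<longlonglongrightarrow> F xs" using isCont_tendsto_compose[OF contF[OF xsK] xs] .
  from tendsto_diff[OF limU this] have limG: "(\<lambda>n. G (u n)) \<longlonglongrightarrow> c" by (simp add: c_def)
  show ?thesis
  proof
    show "xs \<in> K" by (rule xsK)
    show "F xs + c = Us" by (simp add: c_def)
    show "\<forall>b g. (\<forall>v\<in>K. b \<le> G v + g \<bullet> v) \<longrightarrow> b \<le> c + g \<bullet> xs"
    proof (intro allI impI)
      fix b g assume minorant: "\<forall>v\<in>K. b \<le> G v + g \<bullet> v"
      show "b \<le> c + g \<bullet> xs"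
      proof (rule LIMSEQ_le_const)
        show "(\<lambda>n. G (u n) + g \<bullet> u n) \<longlonglongrightarrow> c + g \<bullet> xs" by (intro tendsto_intros limG xs)
      qed (use minorant u in blast)
    qed
    show "\<forall>v\<in>K. 0 \<le> gF xs \<bullet> (v - xs) + (G v - c)"
    proof (intro ballI)
      fix v assume v: "v \<in> K"
      show "0 \<le> gF xs \<bullet> (v - xs) + (G v - c)"
      proof (rule directional_optimality[OF dF[OF xsK]])
        fix t :: real assume t: "0 < t" "t < 1"
        have inK: "s + t *\<^sub>R (v - s) \<in> K" if "s \<in> K" for s
        proof -
          have "(1 - t) *\<^sub>R s + t *\<^sub>R v \<in> K" using cK that v t by (intro convexD) auto
          then show ?thesis by (simp add: algebra_simps)
        qed
        \<comment> \<open>The chord inequality of G is used from \<open>u n\<close> and only then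
          passed to the limit; starting from \<open>xs\<close> it would produce \<open>G xs\<close>
          in place of \<open>c\<close>.\<close>
        have "Us \<le> F (xs + t *\<^sub>R (v - xs)) + ((1 - t) * c + t * G v)"
        proof (rule LIMSEQ_le_const)
          show "(\<lambda>n. F (u n + t *\<^sub>R (v - u n)) + ((1 - t) * G (u n) + t * G v))
              \<longlonglongrightarrow> F (xs + t *\<^sub>R (v - xs)) + ((1 - t) * c + t * G v)"
            by (intro tendsto_intros limG xs isCont_tendsto_compose[OF contF[OF inK[OF xsK]]])
          have "Us \<le> F (u n + t *\<^sub>R (v - u n)) + ((1 - t) * G (u n) + t * G v)" for n
          proof -
            have "G (u n + t *\<^sub>R (v - u n)) \<le> (1 - t) * G (u n) + t * G v"
              using convex_onD[OF G, of t "u n" v] u(1)[of n] v t by (simp add: algebra_simps)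
            then show ?thesis using lower[OF inK[OF u(1)[of n]]] by linarith
          qed
          then show "\<exists>N. \<forall>n\<ge>N. Us \<le> F (u n + t *\<^sub>R (v - u n)) + ((1 - t) * G (u n) + t * G v)" by blast
        qed
        then show "0 \<le> F (xs + t *\<^sub>R (v - xs)) - F xs + t * (G v - c)"
          by (simp add: c_def algebra_simps)
      qed
    qed
  qed
qed

section \<open>Estimates for one damped surrogate step\<close>

lemma norm_le_if_inner_bound:
  fixes v w :: "'a::real_inner"
  assumes "c > 0" "c * (norm v)\<^sup>2 \<le> w \<bullet> v" "norm w \<le> b"
  shows "norm v \<le> b / c"
proof (cases "v = 0")
  case True
  have "0 \<le> b" using assms(3) norm_ge_zero[of w] by linarith
  then show ?thesis using True assms(1) by simp
next
  case False
  have "norm v * (c * norm v) \<le> norm v * b"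
    using assms(2) norm_cauchy_schwarz[of w v] mult_right_mono[OF assms(3) norm_ge_zero[of v]]
    by (simp add: power2_eq_square mult_ac)
  then show ?thesis using False assms(1) by (simp add: field_simps)
qed

text \<open>After \<open>s\<close> is replaced by its bound, the first estimate contains
  \<open>- a * q / 2 * d\<close> and the second \<open>a * D\<^sup>2 / mu * d\<close>. The weights
  \<open>2 * D\<^sup>2\<close> and \<open>q * mu\<close> make these cancel, and division by their
  sum gives the factors.\<close>

lemma weighted_two_bounds:
  fixes p :: real
  assumes q: "q > 0" and mu: "mu > 0" and a: "a \<ge> 0"
    and b1: "pp \<le> p - a * (q * d - s)" and s: "s \<le> q / 2 * d + e / (2 * q)"
    and b2: "pp \<le> (1 - a) * p + a * ((D\<^sup>2 * d + e) / mu)"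
  shows "pp \<le> (1 - a * (q * mu / (q * mu + 2 * D\<^sup>2))) * p
           + a * ((q\<^sup>2 + D\<^sup>2) / (q * (q * mu + 2 * D\<^sup>2))) * e"
proof -
  define N where "N = q * mu + 2 * D\<^sup>2"
  have N: "N > 0" using q mu by (simp add: N_def add_pos_nonneg)
  have "a * s \<le> a * (q / 2 * d + e / (2 * q))" using s a by (rule mult_left_mono)
  then have "pp \<le> p - a * (q / 2 * d) + a * (e / (2 * q))" using b1 by (simp add: algebra_simps)
  then have "2 * D\<^sup>2 * pp \<le> 2 * D\<^sup>2 * (p - a * (q / 2 * d) + a * (e / (2 * q)))"
    by (intro mult_left_mono) auto
  moreover have "q * mu * pp \<le> q * mu * ((1 - a) * p + a * ((D\<^sup>2 * d + e) / mu))"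
    using q mu b2 by (intro mult_left_mono) auto
  moreover have "2 * D\<^sup>2 * (p - a * (q / 2 * d) + a * (e / (2 * q))) + q * mu * ((1 - a) * p + a * ((D\<^sup>2 * d + e) / mu))
      = (N - a * q * mu) * p + a * ((q\<^sup>2 + D\<^sup>2) / q) * e"
    using q mu by (simp add: N_def field_simps power2_eq_square)
  ultimately have "N * pp \<le> (N - a * q * mu) * p + a * ((q\<^sup>2 + D\<^sup>2) / q) * e"
    unfolding N_def by (simp add: algebra_simps)
  then have "pp \<le> ((N - a * q * mu) * p + a * ((q\<^sup>2 + D\<^sup>2) / q) * e) / N"
    using N by (simp add: field_simps)
  also have "\<dots> = (1 - a * (q * mu / N)) * p + a * ((q\<^sup>2 + D\<^sup>2) / (q * N)) * e"
    using N q by (simp add: field_simps)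
  finally show ?thesis by (simp add: N_def)
qed

text \<open>The pair \<open>(xs, c)\<close> plays the role of \<open>(x*, G x*)\<close>: a minimiser of \<open>F + G\<close> need not exist
  because \<open>G\<close> may fail to be lower semicontinuous.\<close>

locale surrogate_step =
  fixes K :: "'a::euclidean_space set" and F G T :: "'a \<Rightarrow> real" and gF tg :: "'a \<Rightarrow> 'a"
    and mu mt Dl D :: real and x xh y xs :: 'a and c :: real
  assumes mu: "mu > 0" and mt: "mt > 0"
    and F_convex: "convex_on K F" and G_convex: "convex_on K G"
    and F_sc: "\<And>a b. a \<in> K \<Longrightarrow> b \<in> K \<Longrightarrow> F a + gF a \<bullet> (b - a) + mu / 2 * (norm (b - a))\<^sup>2 \<le> F b"
    and T_sc: "\<And>a b. a \<in> K \<Longrightarrow> b \<in> K \<Longrightarrow> T a + tg a \<bullet> (b - a) + mt / 2 * (norm (b - a))\<^sup>2 \<le> T b"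
    and D_sc: "\<And>a b. a \<in> K \<Longrightarrow> b \<in> K \<Longrightarrow>
      (T a - F a) + (tg a - gF a) \<bullet> (b - a) + Dl / 2 * (norm (b - a))\<^sup>2 \<le> T b - F b"
    and D_lip: "\<And>a b. a \<in> K \<Longrightarrow> b \<in> K \<Longrightarrow> norm ((tg b - gF b) - (tg a - gF a)) \<le> D * norm (b - a)"
    and xK: "x \<in> K" and xhK: "xh \<in> K" and xsK: "xs \<in> K"
    and xh_opt: "\<And>u. u \<in> K \<Longrightarrow> 0 \<le> (tg xh + y - tg x) \<bullet> (u - xh) + (G u - G xh)"
    and c_lower: "\<And>b g. (\<And>v. v \<in> K \<Longrightarrow> b \<le> G v + g \<bullet> v) \<Longrightarrow> b \<le> c + g \<bullet> xs"
    and xs_opt: "\<And>v. v \<in> K \<Longrightarrow> 0 \<le> gF xs \<bullet> (v - xs) + (G v - c)"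
begin

abbreviation "U s \<equiv> F s + G s"
abbreviation "Us \<equiv> F xs + c"

lemma U_convex: "convex_on K U"
  using F_convex G_convex by (rule convex_on_add)

lemma quadratic_growth: "v \<in> K \<Longrightarrow> mu / 2 * (norm (v - xs))\<^sup>2 \<le> U v - Us"
  using F_sc[OF xsK, of v] xs_opt[of v] by simp

text \<open>Optimality of \<open>xh\<close> is an affine minorant of G on K, so it may be tested at
  the pair (\<open>xs\<close>, \<open>c\<close>) although \<open>G xs\<close> itself may exceed
  \<open>c\<close>.\<close>

lemma xh_opt_xs: "0 \<le> (tg xh + y - tg x) \<bullet> (xs - xh) + (c - G xh)"
  using c_lower[of "G xh + (tg xh + y - tg x) \<bullet> xh" "tg xh + y - tg x"] xh_opt
  by (simp add: inner_diff_right algebra_simps)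

lemma step_in_K: "0 \<le> a \<Longrightarrow> a \<le> 1 \<Longrightarrow> x + a *\<^sub>R (xh - x) \<in> K"
  using convexD[of K x xh "1 - a" a] U_convex xK xhK by (simp add: convex_on_def algebra_simps)

text \<open>F is written as T minus (T - F). Strong convexity of T between x and the new point
  contributes \<open>mt / 2 * a\<^sup>2\<close>, monotonicity of \<open>tg\<close> from there to
  \<open>xh\<close> contributes \<open>mt * a * (1 - a)\<close>, and the curvature of T - F
  contributes \<open>Dl / 2 * a\<^sup>2\<close>; their sum is \<open>a\<close> times the displayed
  coefficient. Optimality of \<open>xh\<close> tested at x pays for the change of G, and all
  surrogate gradients cancel, leaving the tracking error.\<close>

lemma descent:
  assumes a: "0 \<le> a" "a \<le> 1"
  shows "U (x + a *\<^sub>R (xh - x)) \<le> U x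
    - a * (((1 - a / 2) * mt + Dl / 2 * a) * (norm (xh - x))\<^sup>2 - (gF x - y) \<bullet> (xh - x))"
proof -
  define d where "d = xh - x"
  define s where "s = x + a *\<^sub>R d"
  have s: "s \<in> K" using step_in_K[OF a] by (simp add: s_def d_def)
  have sx: "s - x = a *\<^sub>R d" "x - s = - (a *\<^sub>R d)" by (simp_all add: s_def)
  have xs': "xh - s = (1 - a) *\<^sub>R d" "s - xh = - ((1 - a) *\<^sub>R d)" by (simp_all add: s_def d_def algebra_simps)
  have G: "G s \<le> (1 - a) * G x + a * G xh"
    using convex_onD[OF G_convex a xK xhK] by (simp add: s_def d_def algebra_simps)
  have opt: "a * (G xh - G x) \<le> - (a * ((tg xh + y - tg x) \<bullet> d))"
  proof -
    have "x - xh = - d" by (simp add: d_def)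
    then have "G xh - G x \<le> - ((tg xh + y - tg x) \<bullet> d)"
      using xh_opt[OF xK] by simp
    from mult_left_mono[OF this a(1)] show ?thesis by (simp add: algebra_simps)
  qed
  have D: "F s - F x \<le> T s - T x - a * ((tg x - gF x) \<bullet> d) - Dl / 2 * a\<^sup>2 * (norm d)\<^sup>2"
    using D_sc[OF xK s] a by (simp add: sx power_mult_distrib)
  have T1: "T s - T x \<le> a * (tg s \<bullet> d) - mt / 2 * a\<^sup>2 * (norm d)\<^sup>2"
    using T_sc[OF s xK] a by (simp add: sx power_mult_distrib)
  have T2: "a * (mt * (1 - a) * (norm d)\<^sup>2) \<le> a * (tg xh \<bullet> d - tg s \<bullet> d)"
  proof (cases "a = 1")
    case True
    then show ?thesis by (simp add: s_def d_def)
  next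
    case False
    have "(1 - a) * (mt * (1 - a) * (norm d)\<^sup>2) \<le> (1 - a) * (tg xh \<bullet> d - tg s \<bullet> d)"
    proof -
      have "T s + (1 - a) * (tg s \<bullet> d) + mt / 2 * ((1 - a)\<^sup>2 * (norm d)\<^sup>2) \<le> T xh"
        "T xh - (1 - a) * (tg xh \<bullet> d) + mt / 2 * ((1 - a)\<^sup>2 * (norm d)\<^sup>2) \<le> T s"
        using T_sc[OF s xhK] T_sc[OF xhK s] by (simp_all add: xs' power_mult_distrib)
      then show ?thesis by (simp add: power2_eq_square algebra_simps)
    qed
    then have "mt * (1 - a) * (norm d)\<^sup>2 \<le> tg xh \<bullet> d - tg s \<bullet> d" using False a by simp
    then show ?thesis using a(1) by (rule mult_left_mono)
  qed
  show ?thesis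
    using G opt D T1 T2 unfolding d_def[symmetric] s_def[symmetric]
    by (simp add: inner_simps power2_eq_square algebra_simps)
qed

text \<open>Strong convexity of F at \<open>xh\<close> together with \<open>xh_opt_xs\<close> leaves
  a concave quadratic in \<open>xs - xh\<close>, whose maximum is
  \<open>(norm w)\<^sup>2 / (2 * mu)\<close>; the mismatch \<open>w\<close> consists of the
  variation of the gradient of T - F and the tracking error.\<close>

lemma surrogate_minimum_gap:
  "U xh - Us \<le> (D\<^sup>2 * (norm (xh - x))\<^sup>2 + (norm (gF x - y))\<^sup>2) / mu"
proof -
  define w where "w = ((tg x - gF x) - (tg xh - gF xh)) + (gF x - y)"
  define v where "v = xs - xh"
  have w: "norm w \<le> D * norm (xh - x) + norm (gF x - y)"
    unfolding w_def using D_lip[OF xhK xK]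
    by (intro norm_triangle_le add_mono) (simp_all add: norm_minus_commute)
  have "U xh - Us \<le> - (w \<bullet> v) - mu / 2 * (norm v)\<^sup>2"
    using F_sc[OF xhK xsK] xh_opt_xs by (simp add: v_def w_def inner_simps)
  also have "\<dots> \<le> (norm w)\<^sup>2 / (2 * mu)"
  proof -
    have "0 \<le> (norm (w + mu *\<^sub>R v))\<^sup>2" by simp
    also have "\<dots> = (norm w)\<^sup>2 + 2 * mu * (w \<bullet> v) + mu\<^sup>2 * (norm v)\<^sup>2"
      unfolding power2_norm_eq_inner by (simp add: inner_simps inner_commute power2_eq_square algebra_simps)
    finally show ?thesis using mu by (simp add: field_simps power2_eq_square)
  qed
  also have "\<dots> \<le> (2 * (D\<^sup>2 * (norm (xh - x))\<^sup>2 + (norm (gF x - y))\<^sup>2)) / (2 * mu)"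
  proof (rule divide_right_mono)
    have "(norm w)\<^sup>2 \<le> (D * norm (xh - x) + norm (gF x - y))\<^sup>2"
      using w by (rule power_mono) simp
    also have "\<dots> \<le> 2 * ((D * norm (xh - x))\<^sup>2 + (norm (gF x - y))\<^sup>2)"
      using sum_squares_bound[of "D * norm (xh - x)" "norm (gF x - y)"] by (simp add: power2_sum)
    finally show "(norm w)\<^sup>2 \<le> 2 * (D\<^sup>2 * (norm (xh - x))\<^sup>2 + (norm (gF x - y))\<^sup>2)"
      by (simp add: power_mult_distrib)
  qed (use mu in simp)
  also have "\<dots> = (D\<^sup>2 * (norm (xh - x))\<^sup>2 + (norm (gF x - y))\<^sup>2) / mu"
    by (rule mult_divide_mult_cancel_left) simp
  finally show ?thesis .
qed

lemma local_contraction: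
  assumes a: "0 \<le> a" "a \<le> 1" and q: "q = (1 - a / 2) * mt + Dl / 2 * a" "q > 0"
  shows "U (x + a *\<^sub>R (xh - x)) - Us \<le> (1 - a * (q * mu / (q * mu + 2 * D\<^sup>2))) * (U x - Us)
    + a * ((q\<^sup>2 + D\<^sup>2) / (q * (q * mu + 2 * D\<^sup>2))) * (norm (gF x - y))\<^sup>2"
proof (rule weighted_two_bounds[OF q(2) mu a(1)])
  let ?d = "xh - x" and ?e = "gF x - y"
  show "U (x + a *\<^sub>R ?d) - Us \<le> (U x - Us) - a * (q * (norm ?d)\<^sup>2 - ?e \<bullet> ?d)"
    using descent[OF a] by (simp add: q(1))
  \<comment> \<open>Young's inequality with weight \<open>q\<close>, which consumes exactly half of
    the decrease \<open>q * (norm ?d)\<^sup>2\<close>.\<close>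
  have "0 \<le> (norm (?e - q *\<^sub>R ?d))\<^sup>2" by simp
  also have "\<dots> = (norm ?e)\<^sup>2 - 2 * q * (?e \<bullet> ?d) + q\<^sup>2 * (norm ?d)\<^sup>2"
    unfolding power2_norm_eq_inner inner_diff_left inner_diff_right inner_scaleR_left inner_scaleR_right
    by (simp add: inner_commute power2_eq_square algebra_simps)
  finally show "?e \<bullet> ?d \<le> q / 2 * (norm ?d)\<^sup>2 + (norm ?e)\<^sup>2 / (2 * q)"
    using q(2) by (simp add: field_simps power2_eq_square)
  have "U (x + a *\<^sub>R ?d) \<le> (1 - a) * U x + a * U xh"
    using convex_onD[OF U_convex a xK xhK] by (simp add: algebra_simps)
  moreover have "a * (U xh - Us) \<le> a * ((D\<^sup>2 * (norm ?d)\<^sup>2 + (norm ?e)\<^sup>2) / mu)"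
    using surrogate_minimum_gap a(1) by (rule mult_left_mono)
  ultimately show "U (x + a *\<^sub>R ?d) - Us
      \<le> (1 - a) * (U x - Us) + a * ((D\<^sup>2 * (norm ?d)\<^sup>2 + (norm ?e)\<^sup>2) / mu)"
    by (simp add: algebra_simps)
qed

text \<open>Adding the optimality conditions of \<open>xh\<close> and of the pair
  (\<open>xs\<close>, \<open>c\<close>), each tested at the other point, cancels the values of G;
  strong monotonicity of \<open>tg\<close> then bounds the distance from \<open>xh\<close> to
  \<open>xs\<close>.\<close>

lemma direction_bound:
  "norm (xh - x) \<le> (D / mt + 1) * norm (x - xs) + norm (gF x - y) / mt"
proof -
  define w where "w = ((tg x - gF x) - (tg xs - gF xs)) + (gF x - y)"
  have w: "norm w \<le> D * norm (x - xs) + norm (gF x - y)"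
    unfolding w_def using D_lip[OF xsK xK] by (intro norm_triangle_le add_mono) simp_all
  have "mt * (norm (xh - xs))\<^sup>2 \<le> (tg xh - tg xs) \<bullet> (xh - xs)"
    using T_sc[OF xhK xsK] T_sc[OF xsK xhK]
    by (simp add: norm_minus_commute inner_simps algebra_simps)
  also have "\<dots> \<le> w \<bullet> (xh - xs)"
    using xh_opt_xs xs_opt[OF xhK] by (simp add: w_def inner_simps)
  finally have "norm (xh - xs) \<le> (D * norm (x - xs) + norm (gF x - y)) / mt"
    using norm_le_if_inner_bound[OF mt _ w] by blast
  moreover have "norm (xh - x) \<le> norm (xh - xs) + norm (x - xs)"
    using norm_triangle_ineq4[of "xh - xs" "x - xs"] by simp
  ultimately show ?thesis by (simp add: add_divide_distrib distrib_right)
qed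

lemma direction_bound_squared:
  assumes "D \<ge> 0"
  shows "(norm (xh - x))\<^sup>2 \<le> 4 / mu * (D / mt + 1)\<^sup>2 * (U x - Us) + 2 / mt\<^sup>2 * (norm (gF x - y))\<^sup>2"
proof -
  let ?A = "(D / mt + 1) * norm (x - xs)" and ?B = "norm (gF x - y) / mt"
  have "(norm (xh - x))\<^sup>2 \<le> (?A + ?B)\<^sup>2" using direction_bound by (rule power_mono) simp
  also have "\<dots> \<le> 2 * ?A\<^sup>2 + 2 * ?B\<^sup>2"
    using sum_squares_bound[of ?A ?B] by (simp add: power2_sum)
  also have "2 * ?A\<^sup>2 = 4 / mu * (D / mt + 1)\<^sup>2 * (mu / 2 * (norm (x - xs))\<^sup>2)"
    using mu by (simp add: power_mult_distrib)
  also have "\<dots> \<le> 4 / mu * (D / mt + 1)\<^sup>2 * (U x - Us)"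
    using quadratic_growth[OF xK] mu by (intro mult_left_mono) auto
  finally show ?thesis by (simp add: power_divide)
qed

end

subsection \<open>Consensus errors and mixing\<close>

text \<open>The Euclidean norm of the stacked vector of all agents. Stacks are functions on all
  naturals, and entries from m onwards are ignored.\<close>

definition stacked_norm :: "nat \<Rightarrow> (nat \<Rightarrow> 'a::real_normed_vector) \<Rightarrow> real" where
  "stacked_norm m X = L2_set (\<lambda>i. norm (X i)) {..<m}"

definition average :: "nat \<Rightarrow> (nat \<Rightarrow> 'a::real_vector) \<Rightarrow> 'a" where
  "average m X = (1 / real m) *\<^sub>R (\<Sum>j<m. X j)"

definition deviation :: "nat \<Rightarrow> (nat \<Rightarrow> 'a::real_vector) \<Rightarrow> nat \<Rightarrow> 'a" where
  "deviation m X i = X i - average m X"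

definition mix :: "nat \<Rightarrow> (nat \<Rightarrow> nat \<Rightarrow> real) \<Rightarrow> (nat \<Rightarrow> 'a::real_vector) \<Rightarrow> nat \<Rightarrow> 'a" where
  "mix m w X i = (\<Sum>j<m. w i j *\<^sub>R X j)"

lemma stacked_norm_nonneg: "0 \<le> stacked_norm m X"
  by (simp add: stacked_norm_def)

lemma stacked_norm_squared: "(stacked_norm m X)\<^sup>2 = (\<Sum>i<m. (norm (X i))\<^sup>2)"
  by (simp add: stacked_norm_def L2_set_def sum_nonneg)

lemma stacked_norm_mono:
  assumes "\<And>i. i < m \<Longrightarrow> norm (X i) \<le> c * norm (Y i)" "0 \<le> c"
  shows "stacked_norm m X \<le> c * stacked_norm m Y"
  unfolding stacked_norm_def L2_set_right_distrib[OF assms(2)]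
  by (rule L2_set_mono) (use assms in auto)

lemma stacked_norm_cong: "(\<And>i. i < m \<Longrightarrow> X i = Y i) \<Longrightarrow> stacked_norm m X = stacked_norm m Y"
  unfolding stacked_norm_def by (rule L2_set_cong) auto

lemma stacked_norm_triangle:
  "stacked_norm m (\<lambda>i. X i + Y i) \<le> stacked_norm m X + stacked_norm m Y"
  unfolding stacked_norm_def
  by (rule order_trans[OF L2_set_mono L2_set_triangle_ineq]) (auto intro: norm_triangle_ineq)

lemma stacked_norm_scaleR: "stacked_norm m (\<lambda>i. c *\<^sub>R X i) = \<bar>c\<bar> * stacked_norm m X"
  unfolding stacked_norm_def by (simp add: L2_set_right_distrib)

lemma stacked_norm_minus: "stacked_norm m (\<lambda>i. - X i) = stacked_norm m X"
  unfolding stacked_norm_def by simp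

text \<open>The difference of the two sides is the weighted variance about the mean.\<close>

lemma norm_squared_weighted_sum_le:
  fixes X :: "'b \<Rightarrow> 'a::real_inner"
  assumes "\<And>j. j \<in> S \<Longrightarrow> 0 \<le> p j" "sum p S = 1"
  shows "(norm (\<Sum>j\<in>S. p j *\<^sub>R X j))\<^sup>2 \<le> (\<Sum>j\<in>S. p j * (norm (X j))\<^sup>2)"
proof -
  define M where "M = (\<Sum>j\<in>S. p j *\<^sub>R X j)"
  have "0 \<le> (\<Sum>j\<in>S. p j * (norm (X j - M))\<^sup>2)"
    using assms by (intro sum_nonneg) auto
  also have "\<dots> = (\<Sum>j\<in>S. p j * (norm (X j))\<^sup>2) - 2 * ((\<Sum>j\<in>S. p j *\<^sub>R X j) \<bullet> M) + sum p S * (M \<bullet> M)"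
  proof -
    have "p j * (norm (X j - M))\<^sup>2 = p j * (norm (X j))\<^sup>2 - 2 * ((p j *\<^sub>R X j) \<bullet> M) + p j * (M \<bullet> M)" for j
      by (simp add: power2_norm_eq_inner inner_diff_left inner_diff_right inner_commute algebra_simps)
    then show ?thesis
      by (simp only: sum.distrib sum_subtractf inner_sum_left sum_distrib_left sum_distrib_right)
  qed
  also have "\<dots> = (\<Sum>j\<in>S. p j * (norm (X j))\<^sup>2) - (norm M)\<^sup>2"
    by (simp add: assms(2) power2_norm_eq_inner flip: M_def)
  finally show ?thesis by (simp add: M_def)
qed

lemma norm_squared_average_le:
  fixes X :: "nat \<Rightarrow> 'a::real_inner"
  assumes "m \<ge> 1"
  shows "(norm (average m X))\<^sup>2 \<le> (1 / real m) * (\<Sum>j<m. (norm (X j))\<^sup>2)"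
  unfolding average_def scaleR_sum_right sum_distrib_left
  by (rule norm_squared_weighted_sum_le) (use assms in simp_all)

lemma deviation_add: "deviation m (\<lambda>i. X i + Y i) = (\<lambda>i. deviation m X i + deviation m Y i)"
  by (simp add: fun_eq_iff deviation_def average_def sum.distrib scaleR_add_right)

lemma sum_deviation:
  assumes "m \<ge> 1"
  shows "(\<Sum>i<m. deviation m X i) = 0"
proof -
  have "(\<Sum>i<m. average m X) = real m *\<^sub>R average m X"
    using sum_constant_scaleR[of "average m X" "{..<m}"] by simp
  also have "\<dots> = sum X {..<m}" using assms by (simp add: average_def)
  finally show ?thesis by (simp add: deviation_def sum_subtractf)
qed

text \<open>Pythagoras: deviations sum to zero, hence are orthogonal to every constant stack. The
  average is therefore the best constant approximation.\<close>

lemma stacked_norm_shift_squared: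
  fixes X :: "nat \<Rightarrow> 'a::real_inner"
  assumes "m \<ge> 1"
  shows "(stacked_norm m (\<lambda>i. X i - v))\<^sup>2 = (stacked_norm m (deviation m X))\<^sup>2 + real m * (norm (average m X - v))\<^sup>2"
proof -
  have "(stacked_norm m (\<lambda>i. X i - v))\<^sup>2 = (\<Sum>i<m. (norm (deviation m X i + (average m X - v)))\<^sup>2)"
    by (simp add: stacked_norm_squared deviation_def)
  also have "\<dots> = (\<Sum>i<m. (norm (deviation m X i))\<^sup>2) + 2 * ((\<Sum>i<m. deviation m X i) \<bullet> (average m X - v))
      + real m * (norm (average m X - v))\<^sup>2"
  proof -
    have "(norm (a + b))\<^sup>2 = (norm a)\<^sup>2 + 2 * (a \<bullet> b) + (norm b)\<^sup>2" for a b :: 'a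
      by (simp add: power2_norm_eq_inner inner_add_left inner_add_right inner_commute)
    then show ?thesis
      by (simp only: sum.distrib inner_sum_left sum_distrib_left sum_constant card_lessThan)
  qed
  finally show ?thesis using sum_deviation[OF assms, of X] by (simp add: stacked_norm_squared)
qed

lemma stacked_norm_deviation_le:
  fixes X :: "nat \<Rightarrow> 'a::real_inner"
  assumes "m \<ge> 1"
  shows "stacked_norm m (deviation m X) \<le> stacked_norm m (\<lambda>i. X i - v)"
  by (rule power2_le_imp_le) (simp_all add: stacked_norm_shift_squared[OF assms, of X v] stacked_norm_nonneg)

lemma stacked_norm_deviation_le_self:
  fixes X :: "nat \<Rightarrow> 'a::real_inner"
  shows "m \<ge> 1 \<Longrightarrow> stacked_norm m (deviation m X) \<le> stacked_norm m X"
  using stacked_norm_deviation_le[of m X 0] by simp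

text \<open>The shift identity is taken at \<open>v = X i\<close> and averaged over i. Pairwise
  distances appear when the full gradient at one agent's point is compared with the average of local
  gradients taken at different points.\<close>

lemma sum_pairwise_distances:
  fixes X :: "nat \<Rightarrow> 'a::real_inner"
  assumes "m \<ge> 1"
  shows "(\<Sum>i<m. (1 / real m) * (\<Sum>j<m. (norm (X i - X j))\<^sup>2)) = 2 * (stacked_norm m (deviation m X))\<^sup>2"
proof -
  have "(\<Sum>j<m. (norm (X i - X j))\<^sup>2) = (stacked_norm m (deviation m X))\<^sup>2 + real m * (norm (deviation m X i))\<^sup>2" for i
    using stacked_norm_shift_squared[OF assms, of X "X i"]
    by (simp add: stacked_norm_squared norm_minus_commute deviation_def)
  then show ?thesis
    using assms by (simp add: sum.distrib distrib_left add_divide_distrib stacked_norm_squared)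
qed

section \<open>Doubly stochastic mixing and its contraction factor\<close>

locale doubly_stochastic =
  fixes m :: nat and w :: "nat \<Rightarrow> nat \<Rightarrow> real"
  assumes m_pos: "m \<ge> 1"
    and nonneg: "\<And>i j. i < m \<Longrightarrow> j < m \<Longrightarrow> 0 \<le> w i j"
    and row_sum: "\<And>i. i < m \<Longrightarrow> (\<Sum>j<m. w i j) = 1"
    and col_sum: "\<And>j. j < m \<Longrightarrow> (\<Sum>i<m. w i j) = 1"
begin

lemma sum_weighted:
  fixes g :: "nat \<Rightarrow> real"
  shows "(\<Sum>i<m. \<Sum>j<m. w i j * g j) = (\<Sum>j<m. g j)"
  by (subst sum.swap) (simp add: col_sum flip: sum_distrib_right)

lemma average_mix: "average m (mix m w X) = average m X"
  by (simp add: average_def mix_def, subst sum.swap) (simp add: col_sum flip: scaleR_sum_left)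

lemma stacked_norm_mix_le:
  fixes X :: "nat \<Rightarrow> 'a::real_inner"
  shows "stacked_norm m (mix m w X) \<le> stacked_norm m X"
proof (rule power2_le_imp_le)
  have "(stacked_norm m (mix m w X))\<^sup>2 \<le> (\<Sum>i<m. \<Sum>j<m. w i j * (norm (X j))\<^sup>2)"
    unfolding stacked_norm_squared mix_def
    by (intro sum_mono norm_squared_weighted_sum_le) (auto simp: nonneg row_sum)
  also have "\<dots> = (stacked_norm m X)\<^sup>2" by (simp add: sum_weighted stacked_norm_squared)
  finally show "(stacked_norm m (mix m w X))\<^sup>2 \<le> (stacked_norm m X)\<^sup>2" .
qed (rule stacked_norm_nonneg)

lemma centered_mix:
  assumes "i < m"
  shows "(\<Sum>j<m. (w i j - 1 / real m) *\<^sub>R X j) = deviation m (mix m w X) i"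
  unfolding deviation_def average_mix
  by (simp add: mix_def average_def scaleR_diff_left sum_subtractf scaleR_sum_right)

text \<open>The matrix defining \<open>sonata_rho\<close> mixes and then removes the average, so
  \<open>sonata_rho\<close> is the operator norm of that composition.\<close>

lemma rho_set_eq:
  "{sqrt (\<Sum>i<m. (norm (\<Sum>j<m. (w i j - 1 / real m) *\<^sub>R (X j :: 'a)))\<^sup>2) | X. (\<Sum>i<m. (norm (X i))\<^sup>2) \<le> 1}
    = {stacked_norm m (deviation m (mix m w (X :: nat \<Rightarrow> 'a::euclidean_space))) | X. (stacked_norm m X)\<^sup>2 \<le> 1}"
proof -
  have "sqrt (\<Sum>i<m. (norm (\<Sum>j<m. (w i j - 1 / real m) *\<^sub>R X j))\<^sup>2) = stacked_norm m (deviation m (mix m w X))"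
    for X :: "nat \<Rightarrow> 'a"
    unfolding stacked_norm_def L2_set_def by (simp add: centered_mix)
  then show ?thesis by (simp add: stacked_norm_squared)
qed

context
  fixes \<rho> :: real
  assumes \<rho>: "\<rho> = sonata_rho TYPE('a::euclidean_space) m w"
begin

lemma deviation_mix_unit_bound:
  fixes X :: "nat \<Rightarrow> 'a"
  assumes "stacked_norm m X \<le> 1"
  shows "stacked_norm m (deviation m (mix m w X)) \<le> 1"
  using stacked_norm_deviation_le_self[OF m_pos, of "mix m w X"] stacked_norm_mix_le[of X] assms by linarith

lemma unit_iff: "(stacked_norm m X)\<^sup>2 \<le> 1 \<longleftrightarrow> stacked_norm m X \<le> 1"
  by (simp add: power_le_one_iff stacked_norm_nonneg)

lemma rho_upper:
  fixes X :: "nat \<Rightarrow> 'a"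
  assumes "stacked_norm m X \<le> 1"
  shows "stacked_norm m (deviation m (mix m w X)) \<le> \<rho>"
  unfolding \<rho> sonata_rho_def rho_set_eq unit_iff
proof (rule cSup_upper)
  show "bdd_above {stacked_norm m (deviation m (mix m w X)) |X :: nat \<Rightarrow> 'a. stacked_norm m X \<le> 1}"
    by (rule bdd_aboveI[of _ 1]) (auto intro: deviation_mix_unit_bound)
qed (use assms in blast)

lemma rho_nonneg: "0 \<le> \<rho>"
proof -
  have "stacked_norm m (\<lambda>_. 0 :: 'a) \<le> 1" by (simp add: stacked_norm_def L2_set_def)
  from order_trans[OF stacked_norm_nonneg rho_upper[OF this]] show ?thesis .
qed

text \<open>Mixing and removing the average are both nonexpansive. The strict inequality is supplied
  later by the step-size bound.\<close>

lemma rho_le_1: "\<rho> \<le> 1"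
  unfolding \<rho> sonata_rho_def rho_set_eq unit_iff
proof (rule cSup_least)
  have "stacked_norm m (\<lambda>_. 0 :: 'a) \<le> 1" by (simp add: stacked_norm_def L2_set_def)
  then show "{stacked_norm m (deviation m (mix m w X)) |X :: nat \<Rightarrow> 'a. stacked_norm m X \<le> 1} \<noteq> {}"
    by blast
qed (auto intro: deviation_mix_unit_bound)

lemma deviation_mix_le:
  fixes X :: "nat \<Rightarrow> 'a"
  shows "stacked_norm m (deviation m (mix m w X)) \<le> \<rho> * stacked_norm m X"
proof (cases "stacked_norm m X = 0")
  case True
  then show ?thesis
    using stacked_norm_deviation_le_self[OF m_pos, of "mix m w X"] stacked_norm_mix_le[of X] by simp
next
  case False
  define s where "s = stacked_norm m X"
  have s: "s > 0" using False stacked_norm_nonneg[of m X] by (simp add: s_def)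
  have "stacked_norm m (deviation m (mix m w (\<lambda>i. (1 / s) *\<^sub>R X i))) \<le> \<rho>"
    using s by (intro rho_upper) (simp add: stacked_norm_scaleR flip: s_def)
  moreover have "deviation m (mix m w (\<lambda>i. (1 / s) *\<^sub>R X i)) = (\<lambda>i. (1 / s) *\<^sub>R deviation m (mix m w X) i)"
  proof -
    have "mix m w (\<lambda>i. (1 / s) *\<^sub>R X i) = (\<lambda>i. (1 / s) *\<^sub>R mix m w X i)"
      by (simp add: fun_eq_iff mix_def scaleR_sum_right mult.commute)
    then show ?thesis
      by (simp add: fun_eq_iff deviation_def average_def scaleR_diff_right mult.commute flip: scaleR_sum_right)
  qed
  ultimately show ?thesis using s by (simp add: stacked_norm_scaleR field_simps flip: s_def)
qed

lemma mix_deviation: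
  assumes "i < m"
  shows "mix m w (deviation m X) i = deviation m (mix m w X) i"
  unfolding deviation_def average_mix
  by (simp add: mix_def scaleR_diff_right sum_subtractf row_sum[OF assms] flip: scaleR_sum_left)

text \<open>Row sums equal to 1 make mixing fix constant stacks, so only the deviation of X
  contributes, and the operator bound can be applied to it instead of X.\<close>

lemma mixing_contraction:
  fixes X :: "nat \<Rightarrow> 'a"
  shows "stacked_norm m (deviation m (mix m w X)) \<le> \<rho> * stacked_norm m (deviation m X)"
proof -
  have "deviation m (mix m w (deviation m X)) i = deviation m (mix m w X) i" if "i < m" for i
  proof -
    have "average m (deviation m X) = 0"
      unfolding average_def using sum_deviation[OF m_pos, of X] by simp
    then show ?thesis
      using mix_deviation[OF that, of X] by (simp add: deviation_def[of m "mix m w (deviation m X)"] average_mix)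
  qed
  from stacked_norm_cong[OF this] show ?thesis using deviation_mix_le[of "deviation m X"] by simp
qed

lemma mixing_step:
  fixes X Y :: "nat \<Rightarrow> 'a"
  shows "stacked_norm m (deviation m (mix m w (\<lambda>i. X i + Y i)))
    \<le> \<rho> * (stacked_norm m (deviation m X) + stacked_norm m Y)"
proof -
  have "stacked_norm m (deviation m (\<lambda>i. X i + Y i)) \<le> stacked_norm m (deviation m X) + stacked_norm m Y"
    unfolding deviation_add
    using stacked_norm_triangle[of m "deviation m X" "deviation m Y"]
      stacked_norm_deviation_le_self[OF m_pos, of Y] by linarith
  from order_trans[OF mixing_contraction mult_left_mono[OF this rho_nonneg]] show ?thesis .
qed

end

text \<open>Mixing minus the identity annihilates the average, so X enters only by its deviation,
  once mixed and once unmixed. This is the factor 2.\<close>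

lemma mixing_displacement:
  fixes X Y :: "nat \<Rightarrow> 'a::real_inner"
  shows "stacked_norm m (\<lambda>i. mix m w (\<lambda>j. X j + Y j) i - X i)
    \<le> 2 * stacked_norm m (deviation m X) + stacked_norm m Y"
proof -
  have "mix m w (\<lambda>j. X j + Y j) i - X i = (mix m w (deviation m X) i + mix m w Y i) + - deviation m X i"
    if "i < m" for i
    unfolding deviation_def
    by (simp add: mix_def scaleR_diff_right scaleR_add_right sum_subtractf sum.distrib row_sum[OF that]
        flip: scaleR_sum_left)
  from stacked_norm_cong[OF this]
  have "stacked_norm m (\<lambda>i. mix m w (\<lambda>j. X j + Y j) i - X i)
    = stacked_norm m (\<lambda>i. (mix m w (deviation m X) i + mix m w Y i) + - deviation m X i)" .
  also have "\<dots> \<le> stacked_norm m (mix m w (deviation m X)) + stacked_norm m (mix m w Y) + stacked_norm m (deviation m X)"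
    using stacked_norm_triangle[of m "\<lambda>i. mix m w (deviation m X) i + mix m w Y i" "\<lambda>i. - deviation m X i"]
      stacked_norm_triangle[of m "mix m w (deviation m X)" "mix m w Y"]
    by (simp add: stacked_norm_minus)
  also have "\<dots> \<le> 2 * stacked_norm m (deviation m X) + stacked_norm m Y"
    using stacked_norm_mix_le[of "deviation m X"] stacked_norm_mix_le[of Y] by linarith
  finally show ?thesis .
qed

end

subsection \<open>Small gain\<close>

text \<open>The constant reproduces itself because
  \<open>\<rho> * b / (r - \<rho>) + b = r * b / (r - \<rho>)\<close>. The disturbance is controlled
  only on a finite window, since a bound for all times is not yet available in the loop.\<close>

lemma weighted_recursion_bound:
  fixes X B :: "nat \<Rightarrow> real"
  assumes step: "\<And>n. X (Suc n) \<le> \<rho> * X n + B n"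
    and r: "0 \<le> \<rho>" "\<rho> < r" and X0: "0 \<le> X 0" and b: "0 \<le> b"
    and B: "\<And>k. k \<le> N \<Longrightarrow> B k \<le> b * r ^ k"
    and k: "k \<le> Suc N"
  shows "X k \<le> (X 0 + b / (r - \<rho>)) * r ^ k"
  using k
proof (induction k)
  case 0
  then show ?case using r b by simp
next
  case (Suc k)
  have "X (Suc k) \<le> \<rho> * X k + B k" by (rule step)
  also have "\<dots> \<le> \<rho> * ((X 0 + b / (r - \<rho>)) * r ^ k) + b * r ^ k"
    using Suc B[of k] r by (intro add_mono mult_left_mono) auto
  also have "\<dots> = (\<rho> * X 0 + r * (b / (r - \<rho>))) * r ^ k"
    using r by (simp add: field_simps)
  also have "\<dots> \<le> (r * X 0 + r * (b / (r - \<rho>))) * r ^ k"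
    using r X0 by (intro mult_right_mono add_right_mono) auto
  finally show ?case by (simp add: algebra_simps)
qed

text \<open>The summand 1 forces \<open>t > 1\<close> in the contrary case, so the constant term can
  be absorbed into the linear one.\<close>

lemma quadratic_self_bound:
  fixes t :: real
  assumes "t\<^sup>2 \<le> k * t\<^sup>2 + c1 * t + c0" "k < 1" "0 \<le> c1" "0 \<le> c0"
  shows "t \<le> 1 + (c1 + c0) / (1 - k)"
proof (rule ccontr)
  assume "\<not> ?thesis"
  then have t: "1 + (c1 + c0) / (1 - k) < t" by simp
  have "0 \<le> (c1 + c0) / (1 - k)" using assms by simp
  then have t1: "1 < t" and t2: "(c1 + c0) / (1 - k) < t" using t by linarith+
  have "c1 + c0 < (1 - k) * t" using t2 assms(2) by (simp add: field_simps)
  then have "(c1 + c0) * t < (1 - k) * t * t" using t1 by simp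
  moreover have "c0 \<le> c0 * t" using assms(4) t1 by (simp add: mult_le_cancel_left1)
  ultimately show False using assms(1) by (simp add: power2_eq_square algebra_simps)
qed

text \<open>Small-gain argument: with \<open>\<Delta>\<close> the maximum of \<open>d k / r ^ k\<close> over \<open>k \<le> N\<close>, the four recursions
  bound \<open>\<Delta>\<^sup>2\<close> by \<open>\<kappa> \<Delta>\<^sup>2\<close> plus lower-order terms that do not depend on \<open>N\<close>.\<close>

lemma small_gain:
  fixes p X Y d :: "nat \<Rightarrow> real"
  assumes nonneg: "\<And>n. 0 \<le> p n" "\<And>n. 0 \<le> X n" "\<And>n. 0 \<le> Y n" "\<And>n. 0 \<le> d n"
    and hX: "\<And>n. X (Suc n) \<le> \<rho> * (X n + \<alpha> * d n)"
    and hY: "\<And>n. Y (Suc n) \<le> \<rho> * (Y n + L * (2 * X n + \<alpha> * d n))"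
    and hp: "\<And>n. p (Suc n) \<le> \<sigma> * p n + \<eta> * (4 * L\<^sup>2 * (X n)\<^sup>2 + 2 * (Y n)\<^sup>2)"
    and hd: "\<And>n. (d n)\<^sup>2 \<le> C1 * p n + C2 * (Y n)\<^sup>2"
    and r: "0 \<le> \<rho>" "\<rho> < r" and \<sigma>: "0 \<le> \<sigma>" "\<sigma> < r\<^sup>2"
    and pos: "0 \<le> \<eta>" "0 \<le> L" "0 \<le> \<alpha>" "0 \<le> C1" "0 \<le> C2" "0 \<le> g"
    and \<eta>: "\<eta> \<le> 2 * g * (r\<^sup>2 - \<sigma>)"
    and gain: "8 * g * C1 * L\<^sup>2 * (\<alpha> * \<rho> / (r - \<rho>))\<^sup>2
      + (4 * g * C1 + C2) * (\<alpha> * L * \<rho> * (2 * \<rho> / (r - \<rho>) + 1) / (r - \<rho>))\<^sup>2 < 1"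
  shows "\<exists>C. \<forall>n. p n \<le> C * (r\<^sup>2) ^ n"
proof -
  define s where "s = r - \<rho>"
  have s: "s > 0" and r0: "r > 0" using r by (auto simp: s_def)
  have rp: "(c * r ^ n)\<^sup>2 = c\<^sup>2 * (r\<^sup>2) ^ n" for c n
    by (simp add: power_mult_distrib mult.commute flip: power_mult)
  \<comment> \<open>\<open>xi\<close> and \<open>ze\<close> are the gains from the weighted size of
    \<open>d\<close> to those of \<open>X\<close> and \<open>Y\<close>, while \<open>y0\<close>
    collects initial values. With \<open>E\<close> and \<open>H\<close>, which come from inserting
    the bound on \<open>p\<close> into \<open>hd\<close>, the loop gain is \<open>k\<close>.\<close>
  define xi where "xi = \<alpha> * \<rho> / s"
  define ze where "ze = \<alpha> * L * \<rho> * (2 * \<rho> / s + 1) / s"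
  define y0 where "y0 = Y 0 + 2 * L * \<rho> * X 0 / s"
  define E where "E = 8 * g * C1 * L\<^sup>2"
  define H where "H = 4 * g * C1 + C2"
  define k where "k = E * xi\<^sup>2 + H * ze\<^sup>2"
  define c1 where "c1 = 2 * E * X 0 * xi + 2 * H * y0 * ze"
  define c0 where "c0 = C1 * p 0 + E * (X 0)\<^sup>2 + H * y0\<^sup>2"
  define B where "B = 1 + (c1 + c0) / (1 - k)"
  have nn: "0 \<le> xi" "0 \<le> ze" "0 \<le> y0" "0 \<le> E" "0 \<le> H" "0 \<le> c1" "0 \<le> c0"
    using s r pos nonneg by (simp_all add: xi_def ze_def y0_def E_def H_def c1_def c0_def)
  have k: "k < 1" using gain by (simp add: k_def E_def H_def xi_def ze_def s_def)
  \<comment> \<open>Stated for any \<open>t\<close> and window, because it serves twice: with the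
    maximum over a window, and finally with the bound \<open>B\<close> common to all
    windows.\<close>
  have xB: "X n \<le> (X 0 + xi * t) * r ^ n" and yB: "Y n \<le> (y0 + ze * t) * r ^ n"
    and pB: "p n \<le> (p 0 + 2 * g * (4 * L\<^sup>2 * (X 0 + xi * t)\<^sup>2 + 2 * (y0 + ze * t)\<^sup>2)) * (r\<^sup>2) ^ n"
    if t: "0 \<le> t" "\<And>n. n \<le> N \<Longrightarrow> d n \<le> t * r ^ n" and n: "n \<le> N" for n N t
  proof -
    have xb: "X n \<le> (X 0 + xi * t) * r ^ n" if n: "n \<le> N" for n
    proof -
      have "X n \<le> (X 0 + \<rho> * \<alpha> * t / (r - \<rho>)) * r ^ n"
      proof (rule weighted_recursion_bound[where B = "\<lambda>n. \<rho> * \<alpha> * d n" and N = N])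
        show "\<rho> * \<alpha> * d n \<le> \<rho> * \<alpha> * t * r ^ n" if "n \<le> N" for n
          using t(2)[OF that] pos r by (simp add: mult.assoc mult_left_mono)
      qed (use hX r nonneg pos t n in \<open>auto simp: algebra_simps\<close>)
      then show ?thesis by (simp add: xi_def s_def mult_ac)
    qed
    have yb: "Y n \<le> (y0 + ze * t) * r ^ n" if n: "n \<le> N" for n
    proof -
      define b where "b = \<rho> * L * (2 * (X 0 + xi * t) + \<alpha> * t)"
      have "Y n \<le> (Y 0 + b / (r - \<rho>)) * r ^ n"
      proof (rule weighted_recursion_bound[where B = "\<lambda>n. \<rho> * L * (2 * X n + \<alpha> * d n)" and N = N])
        fix n assume n: "n \<le> N"
        have "\<rho> * L * (2 * X n + \<alpha> * d n) \<le> \<rho> * L * (2 * ((X 0 + xi * t) * r ^ n) + \<alpha> * (t * r ^ n))"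
          using xb[OF n] t(2)[OF n] pos r by (intro mult_left_mono add_mono) auto
        then show "\<rho> * L * (2 * X n + \<alpha> * d n) \<le> b * r ^ n"
          by (simp add: b_def algebra_simps)
      qed (use hY r nonneg pos t n nn in \<open>auto simp: algebra_simps b_def\<close>)
      also have "Y 0 + b / (r - \<rho>) = y0 + ze * t"
        using s unfolding s_def[symmetric] by (simp add: b_def y0_def ze_def xi_def field_simps)
      finally show ?thesis .
    qed
    show "X n \<le> (X 0 + xi * t) * r ^ n" "Y n \<le> (y0 + ze * t) * r ^ n"
      using xb yb n by auto
    define u where "u = 4 * L\<^sup>2 * (X 0 + xi * t)\<^sup>2 + 2 * (y0 + ze * t)\<^sup>2"
    have u: "0 \<le> u" by (simp add: u_def)
    have "p n \<le> (p 0 + \<eta> * u / (r\<^sup>2 - \<sigma>)) * (r\<^sup>2) ^ n"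
    proof (rule weighted_recursion_bound[where B = "\<lambda>n. \<eta> * (4 * L\<^sup>2 * (X n)\<^sup>2 + 2 * (Y n)\<^sup>2)" and N = N])
      fix n assume n: "n \<le> N"
      have "(X n)\<^sup>2 \<le> ((X 0 + xi * t) * r ^ n)\<^sup>2" "(Y n)\<^sup>2 \<le> ((y0 + ze * t) * r ^ n)\<^sup>2"
        using xb[OF n] yb[OF n] nonneg by (auto intro: power_mono)
      then have "4 * L\<^sup>2 * (X n)\<^sup>2 + 2 * (Y n)\<^sup>2
          \<le> 4 * L\<^sup>2 * ((X 0 + xi * t) * r ^ n)\<^sup>2 + 2 * ((y0 + ze * t) * r ^ n)\<^sup>2"
        by (intro add_mono mult_left_mono) auto
      also have "\<dots> = u * (r\<^sup>2) ^ n"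
        unfolding rp u_def by (simp add: distrib_right)
      finally show "\<eta> * (4 * L\<^sup>2 * (X n)\<^sup>2 + 2 * (Y n)\<^sup>2) \<le> \<eta> * u * (r\<^sup>2) ^ n"
        using pos(1) by (simp add: mult.assoc mult_left_mono)
    qed (use hp \<sigma> nonneg pos u n in auto)
    also have "\<dots> \<le> (p 0 + 2 * g * u) * (r\<^sup>2) ^ n"
    proof (intro mult_right_mono add_left_mono)
      have "\<eta> * u \<le> 2 * g * (r\<^sup>2 - \<sigma>) * u" using \<eta> u by (rule mult_right_mono)
      then show "\<eta> * u / (r\<^sup>2 - \<sigma>) \<le> 2 * g * u" using \<sigma> by (simp add: field_simps)
    qed simp
    finally show "p n \<le> (p 0 + 2 * g * (4 * L\<^sup>2 * (X 0 + xi * t)\<^sup>2 + 2 * (y0 + ze * t)\<^sup>2)) * (r\<^sup>2) ^ n"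
      by (simp add: u_def)
  qed
  have dB: "d N \<le> B * r ^ N" for N
  proof -
    define t where "t = Max ((\<lambda>n. d n / r ^ n) ` {..N})"
    have dt: "d n \<le> t * r ^ n" if "n \<le> N" for n
    proof -
      have "d n / r ^ n \<le> t" unfolding t_def using that by (intro Max_ge) auto
      then show ?thesis using r0 by (simp add: field_simps)
    qed
    have "t \<in> (\<lambda>n. d n / r ^ n) ` {..N}" unfolding t_def by (rule Max_in) auto
    \<comment> \<open>The maximum is attained, and \<open>hd\<close> at this index makes the window
      bounds into a quadratic inequality for \<open>t\<close> alone.\<close>
    then obtain n where n: "n \<le> N" "t = d n / r ^ n" by blast
    have t0: "0 \<le> t" using n(2) nonneg(4)[of n] r0 by simp
    have "(t * r ^ n)\<^sup>2 = (d n)\<^sup>2" using n r0 by simp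
    also have "\<dots> \<le> C1 * p n + C2 * (Y n)\<^sup>2" by (rule hd)
    also have "\<dots> \<le> C1 * ((p 0 + 2 * g * (4 * L\<^sup>2 * (X 0 + xi * t)\<^sup>2 + 2 * (y0 + ze * t)\<^sup>2)) * (r\<^sup>2) ^ n)
        + C2 * ((y0 + ze * t) * r ^ n)\<^sup>2"
      using pB[OF t0 dt n(1)] yB[OF t0 dt n(1)] pos nonneg
      by (intro add_mono mult_left_mono power_mono) auto
    also have "\<dots> = (C1 * p 0 + E * (X 0 + xi * t)\<^sup>2 + H * (y0 + ze * t)\<^sup>2) * (r\<^sup>2) ^ n"
      unfolding rp E_def H_def by (simp add: algebra_simps)
    finally have "t\<^sup>2 * (r\<^sup>2) ^ n \<le> (C1 * p 0 + E * (X 0 + xi * t)\<^sup>2 + H * (y0 + ze * t)\<^sup>2) * (r\<^sup>2) ^ n"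
      unfolding rp .
    then have "t\<^sup>2 \<le> C1 * p 0 + E * (X 0 + xi * t)\<^sup>2 + H * (y0 + ze * t)\<^sup>2"
      using r0 by (simp only: mult_le_cancel_right_pos zero_less_power)
    also have "\<dots> = k * t\<^sup>2 + c1 * t + c0"
      by (simp add: k_def c1_def c0_def power2_eq_square algebra_simps)
    finally have "t \<le> B" unfolding B_def using k nn by (intro quadratic_self_bound) auto
    then have "t * r ^ N \<le> B * r ^ N" using r0 by simp
    then show ?thesis using dt[of N] by simp
  qed
  have "0 \<le> B" using nn k by (simp add: B_def)
  \<comment> \<open>As \<open>B\<close> does not depend on the window, the bound on \<open>p\<close>
    now holds at every index with one constant.\<close>
  from pB[OF this dB order_refl]
  show ?thesis by blast
qed

text \<open>\<open>E\<close> stands for the product of \<open>GPbar\<close> and \<open>C1\<close>.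
  Splitting \<open>(2 * \<rho> / s + 1)\<^sup>2\<close> into
  \<open>8 * \<rho>\<^sup>2 / s\<^sup>2 + 2\<close> yields the summands \<open>A3\<close> and
  \<open>A2\<close>, and the first term is \<open>A1\<close>. Strictness needs the part carrying
  \<open>s\<^sup>2\<close> to be positive, hence the separate case of vanishing \<rho> or
  \<alpha>.\<close>

lemma gain_less_1:
  fixes \<alpha> \<rho> L s Ah :: real
  assumes \<rho>: "0 \<le> \<rho>" and s: "0 < s" "s < 1" and \<alpha>: "0 \<le> \<alpha>" and L: "0 < L" and E: "0 < E" and H: "0 \<le> H"
    and Ah: "Ah\<^sup>2 = 8 * E * L\<^sup>2 * \<rho>\<^sup>2 + H * (2 * L\<^sup>2 * \<rho>\<^sup>2) + H * (8 * L\<^sup>2 * \<rho> ^ 4)" "0 \<le> Ah"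
    and sA: "\<alpha> * Ah \<le> s\<^sup>2"
  shows "8 * E * L\<^sup>2 * (\<alpha> * \<rho> / s)\<^sup>2 + H * (\<alpha> * L * \<rho> * (2 * \<rho> / s + 1) / s)\<^sup>2 < 1"
proof (cases "\<rho> = 0 \<or> \<alpha> = 0")
  case True
  then show ?thesis by auto
next
  case False
  then have \<rho>0: "\<rho> > 0" and \<alpha>0: "\<alpha> > 0" using \<rho> \<alpha> by auto
  define A where "A = 8 * E * L\<^sup>2 * \<rho>\<^sup>2 + H * (2 * L\<^sup>2 * \<rho>\<^sup>2)"
  define A3 where "A3 = H * (8 * L\<^sup>2 * \<rho> ^ 4)"
  have A: "A > 0" unfolding A_def using \<rho>0 L E H by (intro add_pos_nonneg) auto
  have "(2 * \<rho> / s + 1)\<^sup>2 \<le> 8 * \<rho>\<^sup>2 / s\<^sup>2 + 2"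
    using sum_squares_bound[of "2 * \<rho> / s" 1] by (simp add: power2_sum power_divide power_mult_distrib)
  then have "H * (\<alpha> * L * \<rho> / s)\<^sup>2 * (2 * \<rho> / s + 1)\<^sup>2 \<le> H * (\<alpha> * L * \<rho> / s)\<^sup>2 * (8 * \<rho>\<^sup>2 / s\<^sup>2 + 2)"
    using H by (intro mult_left_mono) auto
  moreover have "H * (\<alpha> * L * \<rho> * (2 * \<rho> / s + 1) / s)\<^sup>2 = H * (\<alpha> * L * \<rho> / s)\<^sup>2 * (2 * \<rho> / s + 1)\<^sup>2"
    by (simp add: power_mult_distrib power_divide)
  ultimately have "8 * E * L\<^sup>2 * (\<alpha> * \<rho> / s)\<^sup>2 + H * (\<alpha> * L * \<rho> * (2 * \<rho> / s + 1) / s)\<^sup>2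
      \<le> 8 * E * L\<^sup>2 * (\<alpha> * \<rho> / s)\<^sup>2 + H * (\<alpha> * L * \<rho> / s)\<^sup>2 * (8 * \<rho>\<^sup>2 / s\<^sup>2 + 2)" by linarith
  also have "\<dots> = \<alpha>\<^sup>2 * (A * s\<^sup>2 + A3) / s ^ 4"
    using s by (simp add: A_def A3_def field_simps power2_eq_square power4_eq_xxxx)
  also have "\<dots> < \<alpha>\<^sup>2 * (A + A3) / s ^ 4"
  proof -
    have "s\<^sup>2 < 1" using s by (simp add: power_less_one_iff)
    then have "A * s\<^sup>2 < A" using A by simp
    then show ?thesis using \<alpha>0 s by (simp add: divide_strict_right_mono)
  qed
  also have "\<dots> = (\<alpha> * Ah)\<^sup>2 / s ^ 4"
    by (simp add: power_mult_distrib Ah A_def A3_def)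
  also have "\<dots> \<le> (s\<^sup>2)\<^sup>2 / s ^ 4"
    using sA \<alpha> Ah(2) s by (intro divide_right_mono power_mono) auto
  also have "\<dots> = 1" using s by (simp flip: power_mult)
  finally show ?thesis .
qed

subsection \<open>The coupled recursions\<close>

text \<open>Surrogates are indexed by iteration as well as by agent because their base point is the
  current iterate. All agents share the constants and the reference pair (\<open>xs\<close>,
  \<open>c\<close>).\<close>

locale sonata_iteration = doubly_stochastic m w
  for m :: nat and w :: "nat \<Rightarrow> nat \<Rightarrow> real" +
  fixes K :: "'a::euclidean_space set" and F G :: "'a \<Rightarrow> real" and T :: "nat \<Rightarrow> nat \<Rightarrow> 'a \<Rightarrow> real"
    and gF :: "'a \<Rightarrow> 'a" and gf :: "nat \<Rightarrow> 'a \<Rightarrow> 'a" and tg :: "nat \<Rightarrow> nat \<Rightarrow> 'a \<Rightarrow> 'a"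
    and mu mt Dl D L \<alpha> :: real and x xh y :: "nat \<Rightarrow> nat \<Rightarrow> 'a" and xs :: 'a and c :: real
  assumes agent: "\<And>n i. i < m \<Longrightarrow>
      surrogate_step K F G (T n i) gF (tg n i) mu mt Dl D (x n i) (xh n i) (y n i) xs c"
    and gF: "\<And>z. gF z = average m (\<lambda>k. gf k z)"
    and lip: "\<And>i a b. i < m \<Longrightarrow> a \<in> K \<Longrightarrow> b \<in> K \<Longrightarrow> norm (gf i b - gf i a) \<le> L * norm (b - a)"
    and y_init: "\<And>i. i < m \<Longrightarrow> y 0 i = gf i (x 0 i)"
    and x_step: "\<And>n i. i < m \<Longrightarrow> x (Suc n) i = mix m w (\<lambda>j. x n j + \<alpha> *\<^sub>R (xh n j - x n j)) i"
    and y_step: "\<And>n i. i < m \<Longrightarrow> y (Suc n) i = mix m w (\<lambda>j. y n j + (gf j (x (Suc n) j) - gf j (x n j))) i"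
    and L: "0 \<le> L" and D: "0 \<le> D" and \<alpha>: "0 \<le> \<alpha>" "\<alpha> \<le> 1"
begin

abbreviation "U s \<equiv> F s + G s"
abbreviation "Us \<equiv> F xs + c"

definition gap :: "nat \<Rightarrow> real" where "gap n = (\<Sum>i<m. U (x n i) - Us)"
definition xdev :: "nat \<Rightarrow> real" where "xdev n = stacked_norm m (deviation m (x n))"
definition ydev :: "nat \<Rightarrow> real" where "ydev n = stacked_norm m (deviation m (y n))"
definition dir :: "nat \<Rightarrow> real" where "dir n = stacked_norm m (\<lambda>i. xh n i - x n i)"
definition err :: "nat \<Rightarrow> real" where "err n = (\<Sum>i<m. (norm (gF (x n i) - y n i))\<^sup>2)"

lemma mu: "mu > 0" and mt: "mt > 0" and U_convex: "convex_on K U"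
proof -
  have step: "surrogate_step K F G (T 0 0) gF (tg 0 0) mu mt Dl D (x 0 0) (xh 0 0) (y 0 0) xs c"
    using m_pos by (intro agent) simp
  show "mu > 0" "mt > 0" "convex_on K U"
    using surrogate_step.mu[OF step] surrogate_step.mt[OF step] surrogate_step.U_convex[OF step] by auto
qed

lemma x_in_K: "i < m \<Longrightarrow> x n i \<in> K"
  using agent unfolding surrogate_step_def by blast

lemma growth: "i < m \<Longrightarrow> mu / 2 * (norm (x n i - xs))\<^sup>2 \<le> U (x n i) - Us"
  using surrogate_step.quadratic_growth[OF agent x_in_K] .

lemma agent_gap_nonneg:
  assumes "i < m"
  shows "0 \<le> U (x n i) - Us"
proof -
  have "0 \<le> mu / 2 * (norm (x n i - xs))\<^sup>2" using mu by simp
  then show ?thesis using growth[OF assms, of n] by linarith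
qed

lemma gap_nonneg: "0 \<le> gap n"
  unfolding gap_def by (intro sum_nonneg agent_gap_nonneg) simp

lemma agent_gap_le: "i < m \<Longrightarrow> U (x n i) - Us \<le> gap n"
  unfolding gap_def by (rule member_le_sum) (use agent_gap_nonneg in auto)

text \<open>Mixing preserves averages, so the gradient increments telescope from the
  initialisation.\<close>

lemma tracking: "average m (y n) = average m (\<lambda>i. gf i (x n i))"
proof (induction n)
  case 0
  then show ?case by (simp add: average_def y_init)
next
  case (Suc n)
  have "average m (y (Suc n)) = average m (mix m w (\<lambda>j. y n j + (gf j (x (Suc n) j) - gf j (x n j))))"
    by (simp add: average_def y_step)
  also have "\<dots> = average m (y n) + (average m (\<lambda>j. gf j (x (Suc n) j)) - average m (\<lambda>j. gf j (x n j)))"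
    unfolding average_mix by (simp add: average_def sum.distrib sum_subtractf scaleR_add_right scaleR_diff_right)
  finally show ?case by (simp add: Suc.IH)
qed

text \<open>By tracking, the error splits into the full gradient at \<open>x n i\<close> minus the
  average of the local gradients, and the deviation of \<open>y\<close>. The first part is averaged
  over agents by Jensen and reduced to pairwise distances.\<close>

lemma err_bound: "err n \<le> 4 * L\<^sup>2 * (xdev n)\<^sup>2 + 2 * (ydev n)\<^sup>2"
proof -
  define g where "g = average m (\<lambda>i. gf i (x n i))"
  have sq: "(norm (a - b))\<^sup>2 \<le> 2 * (norm a)\<^sup>2 + 2 * (norm b)\<^sup>2" for a b :: 'a
  proof -
    have "(norm (a - b))\<^sup>2 \<le> (norm a + norm b)\<^sup>2" by (intro power_mono norm_triangle_ineq4) simp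
    then show ?thesis using sum_squares_bound[of "norm a" "norm b"] by (simp add: power2_sum)
  qed
  have "(norm (gF (x n i) - g))\<^sup>2 \<le> L\<^sup>2 * ((1 / real m) * (\<Sum>j<m. (norm (x n i - x n j))\<^sup>2))"
    if i: "i < m" for i
  proof -
    have "gF (x n i) - g = average m (\<lambda>j. gf j (x n i) - gf j (x n j))"
      by (simp add: g_def gF average_def sum_subtractf scaleR_diff_right)
    then have "(norm (gF (x n i) - g))\<^sup>2 \<le> (1 / real m) * (\<Sum>j<m. (norm (gf j (x n i) - gf j (x n j)))\<^sup>2)"
      using norm_squared_average_le[OF m_pos] by simp
    also have "\<dots> \<le> (1 / real m) * (\<Sum>j<m. (L * norm (x n i - x n j))\<^sup>2)"
      using i by (intro mult_left_mono sum_mono power_mono lip) (auto intro: x_in_K)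
    finally show ?thesis by (simp add: power_mult_distrib sum_distrib_left mult_ac)
  qed
  then have "(\<Sum>i<m. (norm (gF (x n i) - g))\<^sup>2) \<le> (\<Sum>i<m. L\<^sup>2 * ((1 / real m) * (\<Sum>j<m. (norm (x n i - x n j))\<^sup>2)))"
    by (intro sum_mono) auto
  also have "\<dots> = 2 * L\<^sup>2 * (xdev n)\<^sup>2"
    unfolding sum_distrib_left[symmetric, of "L\<^sup>2"] sum_pairwise_distances[OF m_pos] xdev_def by simp
  finally have "2 * (\<Sum>i<m. (norm (gF (x n i) - g))\<^sup>2) \<le> 4 * L\<^sup>2 * (xdev n)\<^sup>2" by simp
  moreover have "err n \<le> (\<Sum>i<m. 2 * (norm (gF (x n i) - g))\<^sup>2 + 2 * (norm (deviation m (y n) i))\<^sup>2)"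
    unfolding err_def
  proof (intro sum_mono)
    fix i
    have eq: "gF (x n i) - y n i = (gF (x n i) - g) - deviation m (y n) i"
      by (simp add: deviation_def tracking g_def)
    show "(norm (gF (x n i) - y n i))\<^sup>2 \<le> 2 * (norm (gF (x n i) - g))\<^sup>2 + 2 * (norm (deviation m (y n) i))\<^sup>2"
      unfolding eq by (rule sq)
  qed
  ultimately show ?thesis
    by (simp add: sum.distrib ydev_def stacked_norm_squared flip: sum_distrib_left)
qed

text \<open>Mixing does not increase the total gap: Jensen for U uses the row sums, and summation
  over agents uses the column sums.\<close>

lemma gap_step:
  assumes q: "q = (1 - \<alpha> / 2) * mt + Dl / 2 * \<alpha>" "q > 0"
  shows "gap (Suc n) \<le> (1 - \<alpha> * (q * mu / (q * mu + 2 * D\<^sup>2))) * gap n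
    + \<alpha> * ((q\<^sup>2 + D\<^sup>2) / (q * (q * mu + 2 * D\<^sup>2))) * (4 * L\<^sup>2 * (xdev n)\<^sup>2 + 2 * (ydev n)\<^sup>2)"
proof -
  define \<sigma> where "\<sigma> = 1 - \<alpha> * (q * mu / (q * mu + 2 * D\<^sup>2))"
  define \<eta> where "\<eta> = \<alpha> * ((q\<^sup>2 + D\<^sup>2) / (q * (q * mu + 2 * D\<^sup>2)))"
  have \<eta>: "0 \<le> \<eta>" using \<alpha> q(2) mu by (simp add: \<eta>_def)
  define s where "s j = x n j + \<alpha> *\<^sub>R (xh n j - x n j)" for j
  have sK: "s j \<in> K" if "j < m" for j
    using surrogate_step.step_in_K[OF agent[OF that] \<alpha>] by (simp add: s_def)
  have "U (x (Suc n) i) - Us \<le> (\<Sum>j<m. w i j * (U (s j) - Us))" if i: "i < m" for i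
  proof -
    have "U (\<Sum>j<m. w i j *\<^sub>R s j) \<le> (\<Sum>j<m. w i j * U (s j))"
      using m_pos by (intro convex_on_sum[OF _ _ U_convex]) (auto simp: row_sum[OF i] nonneg i sK lessThan_empty_iff)
    moreover have "(\<Sum>j<m. w i j * (U (s j) - Us)) = (\<Sum>j<m. w i j * U (s j)) - Us"
      by (simp add: right_diff_distrib sum_subtractf row_sum[OF i] flip: sum_distrib_right)
    moreover have "x (Suc n) i = (\<Sum>j<m. w i j *\<^sub>R s j)"
      by (simp add: x_step[OF i] mix_def s_def)
    ultimately show ?thesis by simp
  qed
  then have "gap (Suc n) \<le> (\<Sum>i<m. \<Sum>j<m. w i j * (U (s j) - Us))"
    unfolding gap_def by (intro sum_mono) auto
  also have "\<dots> = (\<Sum>j<m. U (s j) - Us)" by (rule sum_weighted)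
  also have "\<dots> \<le> (\<Sum>j<m. \<sigma> * (U (x n j) - Us) + \<eta> * (norm (gF (x n j) - y n j))\<^sup>2)"
    unfolding s_def \<sigma>_def \<eta>_def
    by (intro sum_mono surrogate_step.local_contraction[OF agent \<alpha> q]) simp
  also have "\<dots> = \<sigma> * gap n + \<eta> * err n"
    by (simp add: sum.distrib gap_def err_def sum_distrib_left)
  also have "\<dots> \<le> \<sigma> * gap n + \<eta> * (4 * L\<^sup>2 * (xdev n)\<^sup>2 + 2 * (ydev n)\<^sup>2)"
    using err_bound \<eta> by (intro add_left_mono mult_left_mono)
  finally show ?thesis by (simp add: \<sigma>_def \<eta>_def)
qed

text \<open>The consensus error of \<open>x\<close> is at most the distance of the stack to
  \<open>xs\<close>, which quadratic growth bounds by the gap; thus only \<open>gap\<close> and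
  \<open>ydev\<close> remain.\<close>

lemma dir_bound: "(dir n)\<^sup>2 \<le> sonata_C1 mu mt D L * gap n + sonata_C2 mt * (ydev n)\<^sup>2"
proof -
  have "(xdev n)\<^sup>2 \<le> (\<Sum>i<m. (norm (x n i - xs))\<^sup>2)"
    unfolding xdev_def stacked_norm_squared[of m "\<lambda>i. x n i - xs", symmetric]
    by (intro power_mono stacked_norm_deviation_le m_pos stacked_norm_nonneg)
  then have "mu / 2 * (xdev n)\<^sup>2 \<le> mu / 2 * (\<Sum>i<m. (norm (x n i - xs))\<^sup>2)"
    using mu by (intro mult_left_mono) auto
  also have "\<dots> \<le> gap n"
    unfolding gap_def sum_distrib_left by (intro sum_mono growth) simp
  finally have X: "(xdev n)\<^sup>2 \<le> 2 / mu * gap n" using mu by (simp add: field_simps)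
  have "(dir n)\<^sup>2 \<le> (\<Sum>i<m. 4 / mu * (D / mt + 1)\<^sup>2 * (U (x n i) - Us) + 2 / mt\<^sup>2 * (norm (gF (x n i) - y n i))\<^sup>2)"
    unfolding dir_def stacked_norm_squared
    by (intro sum_mono surrogate_step.direction_bound_squared[OF agent D]) simp
  also have "\<dots> = 4 / mu * (D / mt + 1)\<^sup>2 * gap n + 2 / mt\<^sup>2 * err n"
    by (simp only: sum.distrib gap_def err_def sum_distrib_left)
  also have "\<dots> \<le> 4 / mu * (D / mt + 1)\<^sup>2 * gap n + 2 / mt\<^sup>2 * (4 * L\<^sup>2 * (2 / mu * gap n) + 2 * (ydev n)\<^sup>2)"
  proof (intro add_left_mono mult_left_mono)
    have "4 * L\<^sup>2 * (xdev n)\<^sup>2 \<le> 4 * L\<^sup>2 * (2 / mu * gap n)" using X by (intro mult_left_mono) auto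
    then show "err n \<le> 4 * L\<^sup>2 * (2 / mu * gap n) + 2 * (ydev n)\<^sup>2" using err_bound[of n] by linarith
  qed simp
  also have "\<dots> = 4 / mu * ((D / mt + 1)\<^sup>2 + 4 * L\<^sup>2 / mt\<^sup>2) * gap n + sonata_C2 mt * (ydev n)\<^sup>2"
    by (simp add: sonata_C2_def algebra_simps)
  \<comment> \<open>The factor \<open>4 / mu\<close> reached here is relaxed to the
    \<open>6 / mu\<close> of \<open>sonata_C1\<close>.\<close>
  also have "\<dots> \<le> sonata_C1 mu mt D L * gap n + sonata_C2 mt * (ydev n)\<^sup>2"
    unfolding sonata_C1_def using mu gap_nonneg
    by (intro add_right_mono mult_right_mono divide_right_mono) auto
  finally show ?thesis .
qed

context
  fixes \<rho> :: real
  assumes \<rho>: "\<rho> = sonata_rho TYPE('a) m w"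
begin

lemma xdev_step: "xdev (Suc n) \<le> \<rho> * (xdev n + \<alpha> * dir n)"
proof -
  have "xdev (Suc n) = stacked_norm m (deviation m (mix m w (\<lambda>j. x n j + \<alpha> *\<^sub>R (xh n j - x n j))))"
    unfolding xdev_def by (rule stacked_norm_cong) (simp add: deviation_def average_def x_step)
  then show ?thesis
    using mixing_step[OF \<rho>, of "x n" "\<lambda>j. \<alpha> *\<^sub>R (xh n j - x n j)"] \<alpha>
    by (simp add: stacked_norm_scaleR xdev_def dir_def)
qed

lemma ydev_step: "ydev (Suc n) \<le> \<rho> * (ydev n + L * (2 * xdev n + \<alpha> * dir n))"
proof -
  let ?dg = "\<lambda>j. gf j (x (Suc n) j) - gf j (x n j)"
  have "stacked_norm m ?dg \<le> L * stacked_norm m (\<lambda>i. x (Suc n) i - x n i)"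
    by (rule stacked_norm_mono) (use L in \<open>auto intro: lip x_in_K\<close>)
  also have "\<dots> \<le> L * (2 * xdev n + \<alpha> * dir n)"
  proof (rule mult_left_mono[OF _ L])
    have "stacked_norm m (\<lambda>i. x (Suc n) i - x n i)
      = stacked_norm m (\<lambda>i. mix m w (\<lambda>j. x n j + \<alpha> *\<^sub>R (xh n j - x n j)) i - x n i)"
      by (rule stacked_norm_cong) (simp add: x_step)
    then show "stacked_norm m (\<lambda>i. x (Suc n) i - x n i) \<le> 2 * xdev n + \<alpha> * dir n"
      using mixing_displacement[of "x n" "\<lambda>j. \<alpha> *\<^sub>R (xh n j - x n j)"] \<alpha>
      by (simp add: stacked_norm_scaleR xdev_def dir_def)
  qed
  finally have dg: "stacked_norm m ?dg \<le> L * (2 * xdev n + \<alpha> * dir n)" .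
  have "ydev (Suc n) = stacked_norm m (deviation m (mix m w (\<lambda>j. y n j + ?dg j)))"
    unfolding ydev_def by (rule stacked_norm_cong) (simp add: deviation_def average_def y_step)
  also have "\<dots> \<le> \<rho> * (ydev n + stacked_norm m ?dg)"
    unfolding ydev_def by (rule mixing_step[OF \<rho>])
  also have "\<dots> \<le> \<rho> * (ydev n + L * (2 * xdev n + \<alpha> * dir n))"
    using dg rho_nonneg[OF \<rho>] by (intro mult_left_mono add_left_mono)
  finally show ?thesis .
qed

end

end

subsection \<open>Step-size and rate\<close>

text \<open>The local factor is \<open>\<sigma> = 1 - \<alpha> * h\<close>, and
  \<open>q \<ge> mt / 2\<close> gives \<open>h \<ge> 2 * J\<close>. Hence z exceeds \<sigma> by at
  least \<open>\<alpha> * h / 2\<close>, and \<eta> equals that quantity times twice the curvature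
  ratio bounded by \<open>g\<close>.\<close>

lemma contraction_vs_rate:
  fixes q mt mu D \<alpha> z :: real
  assumes q: "mt / 2 \<le> q" and mt: "mt > 0" and mu: "mu > 0" and \<alpha>: "0 < \<alpha>" "\<alpha> \<le> 1"
    and z: "1 - sonata_J mu mt D * \<alpha> \<le> z" and g: "(q\<^sup>2 + D\<^sup>2) / (q\<^sup>2 * mu) \<le> g"
  defines "\<sigma> \<equiv> 1 - \<alpha> * (q * mu / (q * mu + 2 * D\<^sup>2))"
    and "\<eta> \<equiv> \<alpha> * ((q\<^sup>2 + D\<^sup>2) / (q * (q * mu + 2 * D\<^sup>2)))"
  shows "0 \<le> \<sigma>" "\<sigma> < z" "0 \<le> \<eta>" "\<eta> \<le> 2 * g * (z - \<sigma>)"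
proof -
  have q0: "q > 0" using q mt by simp
  define N where "N = q * mu + 2 * D\<^sup>2"
  have N: "N > 0" using q0 mu by (simp add: N_def add_pos_nonneg)
  define h where "h = q * mu / N"
  have h: "0 < h" "h \<le> 1" using q0 mu N by (simp_all add: h_def N_def)
  have "mt * mu * N \<le> q * mu * (4 * D\<^sup>2 + mt * mu)"
  proof -
    have "mt * (2 * mu * D\<^sup>2) \<le> 2 * q * (2 * mu * D\<^sup>2)"
      using q mu by (intro mult_right_mono) auto
    then show ?thesis by (simp add: N_def algebra_simps)
  qed
  then have "mt * mu / (4 * D\<^sup>2 + mt * mu) \<le> h"
    using N mt mu by (simp add: h_def divide_simps add_nonneg_pos)
  then have "sonata_J mu mt D \<le> h / 2" unfolding sonata_J_def by linarith
  then have "\<alpha> * sonata_J mu mt D \<le> \<alpha> * (h / 2)" using \<alpha> by (intro mult_left_mono) auto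
  then have zs: "\<alpha> * h / 2 \<le> z - \<sigma>"
  proof -
    have "\<sigma> = 1 - \<alpha> * h" by (simp add: \<sigma>_def h_def N_def)
    then show ?thesis using z \<open>\<alpha> * sonata_J mu mt D \<le> \<alpha> * (h / 2)\<close> by (simp add: mult.commute)
  qed
  have ah: "\<alpha> * h \<le> 1" using \<alpha> h by (simp add: mult_le_one)
  then show "0 \<le> \<sigma>" by (simp add: \<sigma>_def h_def N_def)
  have "0 < \<alpha> * h" using \<alpha> h by simp
  then show "\<sigma> < z" using zs by linarith
  show "0 \<le> \<eta>" using \<alpha> q0 N by (simp add: \<eta>_def N_def[symmetric])
  have "0 \<le> (q\<^sup>2 + D\<^sup>2) / (q\<^sup>2 * mu)" using mu by simp
  then have g0: "0 \<le> g" using g by linarith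
  have "\<eta> = 2 * ((q\<^sup>2 + D\<^sup>2) / (q\<^sup>2 * mu)) * (\<alpha> * h / 2)"
    using q0 mu N unfolding \<eta>_def N_def[symmetric] h_def by (simp add: field_simps power2_eq_square)
  also have "\<dots> \<le> 2 * g * (z - \<sigma>)"
    using g zs g0 mu \<open>0 < \<alpha> * h\<close> by (intro mult_mono) auto
  finally show "\<eta> \<le> 2 * g * (z - \<sigma>)" .
qed

lemma GPstar_eq:
  assumes "mu > 0" "q = (1 - a / 2) * mt + Dl / 2 * a" "q > 0"
  shows "GPstar mu mt Dl D a = (q\<^sup>2 + D\<^sup>2) / (q\<^sup>2 * mu)"
  using assms by (simp add: GPstar_def Let_def flip: assms(2)) (simp add: field_simps)

text \<open>\<open>q = mt - \<alpha> / 2 * (mt - Dl)\<close> is nonincreasing in \<alpha> and equals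
  \<open>mt / 2\<close> at \<open>abar\<close>, while the ratio decreases in \<open>q\<close>. If
  \<open>mt = Dl\<close>, then \<open>q\<close> is constantly \<open>mt\<close>.\<close>

lemma step_curvature:
  fixes mt Dl mu D \<alpha> :: real
  assumes mt: "mt > 0" and mu: "mu > 0" and Dl: "Dl \<le> mt" and \<alpha>: "0 < \<alpha>" "ereal \<alpha> < abar mt Dl"
  defines "q \<equiv> (1 - \<alpha> / 2) * mt + Dl / 2 * \<alpha>"
  shows "mt / 2 \<le> q" "(q\<^sup>2 + D\<^sup>2) / (q\<^sup>2 * mu) \<le> GPbar mu mt Dl D"
proof -
  have gmono: "(q\<^sup>2 + D\<^sup>2) / (q\<^sup>2 * mu) \<le> (p\<^sup>2 + D\<^sup>2) / (p\<^sup>2 * mu)" if p: "0 < p" "p \<le> q" for p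
  proof -
    have "(s\<^sup>2 + D\<^sup>2) / (s\<^sup>2 * mu) = 1 / mu + D\<^sup>2 / mu / s\<^sup>2" if "s > 0" for s :: real
      using that mu by (simp add: field_simps)
    moreover have "D\<^sup>2 / mu / q\<^sup>2 \<le> D\<^sup>2 / mu / p\<^sup>2"
      using p mu by (intro divide_left_mono power_mono mult_pos_pos) auto
    ultimately show ?thesis using p by simp
  qed
  show "mt / 2 \<le> q" "(q\<^sup>2 + D\<^sup>2) / (q\<^sup>2 * mu) \<le> GPbar mu mt Dl D"
  proof (atomize (full), cases "mt = Dl")
    case True
    then have "q = mt" by (simp add: q_def algebra_simps)
    moreover have "GPbar mu mt Dl D = (mt\<^sup>2 + D\<^sup>2) / (mt\<^sup>2 * mu)"
      using True mt GPstar_eq[OF mu, of mt 0 mt Dl D] by (simp add: GPbar_def)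
    ultimately show "mt / 2 \<le> q \<and> (q\<^sup>2 + D\<^sup>2) / (q\<^sup>2 * mu) \<le> GPbar mu mt Dl D"
      using mt by simp
  next
    case False
    then have less: "mt - Dl > 0" using Dl by simp
    have "\<alpha> * (mt - Dl) < mt" using \<alpha>(2) False less by (simp add: abar_def field_simps)
    then have q: "mt / 2 \<le> q" by (simp add: q_def algebra_simps)
    define a where "a = mt / (mt - Dl)"
    have "a * (mt - Dl) = mt" using less by (simp add: a_def)
    then have "mt / 2 = (1 - a / 2) * mt + Dl / 2 * a" by (simp add: field_simps)
    from GPstar_eq[OF mu this, of D] have "GPbar mu mt Dl D = ((mt / 2)\<^sup>2 + D\<^sup>2) / ((mt / 2)\<^sup>2 * mu)"
      using False mt by (simp add: GPbar_def a_def)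
    then show "mt / 2 \<le> q \<and> (q\<^sup>2 + D\<^sup>2) / (q\<^sup>2 * mu) \<le> GPbar mu mt Dl D"
      using q gmono[of "mt / 2"] mt by simp
  qed
qed

text \<open>\<open>sqrt (sonata_astar A J \<rho>)\<close> is the nonnegative root of
  \<open>(\<rho> + t * sqrt A)\<^sup>2 = 1 - J * t\<^sup>2\<close>, so \<open>z\<close> is the larger of the two candidate rates.\<close>

lemma rate_dominates:
  fixes A J \<rho> \<alpha> z :: real
  assumes A: "0 \<le> A" and J: "0 < J" "J \<le> 1 / 2" and \<rho>: "0 \<le> \<rho>" "\<rho> \<le> 1" and \<alpha>: "0 < \<alpha>" "\<alpha> \<le> 1"
    and A0: "A = 0 \<Longrightarrow> \<rho> = 0" and max: "A \<noteq> 0 \<Longrightarrow> \<alpha> < (1 - \<rho>)\<^sup>2 / A"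
    and z: "z = (if \<alpha> < sonata_astar A J \<rho> then 1 - J * \<alpha> else (\<rho> + sqrt (\<alpha> * A))\<^sup>2)"
  shows "1 - J * \<alpha> \<le> z" "\<rho> + sqrt (\<alpha> * A) \<le> sqrt z" "0 < z" "z < 1"
proof -
  define t where "t = sqrt \<alpha>"
  define a where "a = sqrt A"
  have t: "t > 0" "t\<^sup>2 = \<alpha>" and a: "a \<ge> 0" "a\<^sup>2 = A" "sqrt (\<alpha> * A) = t * a"
    using \<alpha> A by (simp_all add: t_def a_def real_sqrt_mult)
  define R where "R = sqrt (A + J * (1 - \<rho>\<^sup>2))"
  define \<tau> where "\<tau> = (- \<rho> * a + R) / (A + J)"
  have AJ: "A + J > 0" using A J by simp
  have \<rho>2: "\<rho>\<^sup>2 \<le> 1" using \<rho> by (simp add: power_le_one)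
  have R2: "R\<^sup>2 = A + J * (1 - \<rho>\<^sup>2)" using A J \<rho>2 by (simp add: R_def)
  have "\<rho> * a \<le> R"
  proof (rule power2_le_imp_le)
    have "\<rho>\<^sup>2 * A \<le> A" using mult_right_mono[OF \<rho>2 A] by simp
    moreover have "0 \<le> J * (1 - \<rho>\<^sup>2)" using J \<rho>2 by simp
    ultimately show "(\<rho> * a)\<^sup>2 \<le> R\<^sup>2" by (simp add: power_mult_distrib a R2)
  qed (use A J \<rho>2 in \<open>simp add: R_def\<close>)
  then have \<tau>0: "\<tau> \<ge> 0" using AJ by (simp add: \<tau>_def)
  have Rt: "(A + J) * \<tau> + \<rho> * a = R" using AJ by (simp add: \<tau>_def)
  have "(A + J) * ((A + J) * \<tau>\<^sup>2 + 2 * \<rho> * a * \<tau>) = ((A + J) * \<tau> + \<rho> * a)\<^sup>2 - \<rho>\<^sup>2 * a\<^sup>2"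
    by (simp add: power2_eq_square algebra_simps)
  also have "\<dots> = (A + J) * (1 - \<rho>\<^sup>2)"
    unfolding Rt R2 a(2) by (simp add: algebra_simps)
  finally have root: "(A + J) * \<tau>\<^sup>2 + 2 * \<rho> * a * \<tau> = 1 - \<rho>\<^sup>2" using AJ by simp
  have star: "sonata_astar A J \<rho> = \<tau>\<^sup>2" by (simp add: sonata_astar_def \<tau>_def R_def a_def)
  \<comment> \<open>The difference of the two candidate rates is the increment from \<tau> to
    \<open>t\<close> of the quadratic \<open>(A + J) * u\<^sup>2 + 2 * \<rho> * a * u\<close>,
    increasing for nonnegative u; so comparing rates means comparing \<open>t\<close> with
    \<tau>.\<close>
  have diff: "(\<rho> + t * a)\<^sup>2 - (1 - J * \<alpha>)
      = ((A + J) * t\<^sup>2 + 2 * \<rho> * a * t) - ((A + J) * \<tau>\<^sup>2 + 2 * \<rho> * a * \<tau>)"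
  proof -
    have "(\<rho> + t * a)\<^sup>2 = \<rho>\<^sup>2 + 2 * \<rho> * a * t + a\<^sup>2 * t\<^sup>2"
      by (simp add: power2_eq_square algebra_simps)
    then show ?thesis unfolding root a(2) t(2) by (simp add: distrib_right)
  qed
  have mono: "(A + J) * u\<^sup>2 + 2 * \<rho> * a * u \<le> (A + J) * v\<^sup>2 + 2 * \<rho> * a * v" if "0 \<le> u" "u \<le> v" for u v
    using that AJ \<rho> a(1) by (intro add_mono mult_left_mono power_mono) auto
  have Ja: "0 < J * \<alpha>" "J * \<alpha> < 1"
    using J \<alpha> mult_mono[of J "1 / 2" \<alpha> 1] by auto
  \<comment> \<open>If A vanishes, the quotient bound on \<alpha> is absent, but then \<rho> is
    0.\<close>
  have lt1: "\<rho> + t * a < 1"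
  proof (cases "A = 0")
    case True
    then show ?thesis using A0 by (simp add: a_def)
  next
    case False
    then have "\<alpha> * A < (1 - \<rho>)\<^sup>2" using max A by (simp add: pos_less_divide_eq)
    then have "(t * a)\<^sup>2 < (1 - \<rho>)\<^sup>2" by (simp add: power_mult_distrib t(2) a(2))
    then have "t * a < 1 - \<rho>" by (rule power2_less_imp_less) (use \<rho> in simp)
    then show ?thesis by simp
  qed
  have ge0: "0 \<le> \<rho> + t * a" using \<rho> t a by simp
  have "1 - J * \<alpha> \<le> z \<and> \<rho> + t * a \<le> sqrt z \<and> z < 1"
  proof (cases "\<alpha> < sonata_astar A J \<rho>")
    case True
    then have "t\<^sup>2 < \<tau>\<^sup>2" by (simp add: star t(2))
    then have "t < \<tau>" using \<tau>0 by (rule power2_less_imp_less)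
    then have "(\<rho> + t * a)\<^sup>2 \<le> 1 - J * \<alpha>" using diff mono[of t \<tau>] t by linarith
    then show ?thesis using z True Ja by (simp add: real_le_rsqrt)
  next
    case False
    then have "\<tau>\<^sup>2 \<le> t\<^sup>2" by (simp add: star t(2))
    then have "\<tau> \<le> t" by (rule power2_le_imp_le) (use t in simp)
    then have "1 - J * \<alpha> \<le> (\<rho> + t * a)\<^sup>2" using diff mono[of \<tau> t] \<tau>0 by linarith
    moreover have "(\<rho> + t * a)\<^sup>2 < 1" using lt1 ge0 by (simp add: power_less_one_iff)
    ultimately show ?thesis using z False ge0 by (simp add: a(3))
  qed
  then show "1 - J * \<alpha> \<le> z" "\<rho> + sqrt (\<alpha> * A) \<le> sqrt z" "0 < z" "z < 1"
    using Ja by (simp_all add: a(3))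
qed

lemma sonata_Ahalf_squared:
  assumes "0 \<le> C2" "0 \<le> g" "0 \<le> C1"
    and "C1 = sonata_C1 mu mt D L" "C2 = sonata_C2 mt" "g = GPbar mu mt Dl D"
  shows "(sonata_Ahalf mu mt Dl D L \<rho>)\<^sup>2 = 8 * (g * C1) * L\<^sup>2 * \<rho>\<^sup>2
    + (4 * (g * C1) + C2) * (2 * L\<^sup>2 * \<rho>\<^sup>2) + (4 * (g * C1) + C2) * (8 * L\<^sup>2 * \<rho> ^ 4)"
    and "0 \<le> sonata_Ahalf mu mt Dl D L \<rho>"
proof -
  have "sonata_Ahalf mu mt Dl D L \<rho> = sqrt (8 * (g * C1) * L\<^sup>2 * \<rho>\<^sup>2
    + (4 * (g * C1) + C2) * (2 * L\<^sup>2 * \<rho>\<^sup>2) + (4 * (g * C1) + C2) * (8 * L\<^sup>2 * \<rho> ^ 4))"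
    by (simp add: sonata_Ahalf_def Let_def assms(4-6) mult_ac)
  moreover have "0 \<le> 8 * (g * C1) * L\<^sup>2 * \<rho>\<^sup>2
    + (4 * (g * C1) + C2) * (2 * L\<^sup>2 * \<rho>\<^sup>2) + (4 * (g * C1) + C2) * (8 * L\<^sup>2 * \<rho> ^ 4)"
    using assms(1-3) by (intro add_nonneg_nonneg mult_nonneg_nonneg) simp_all
  ultimately show "(sonata_Ahalf mu mt Dl D L \<rho>)\<^sup>2 = 8 * (g * C1) * L\<^sup>2 * \<rho>\<^sup>2
    + (4 * (g * C1) + C2) * (2 * L\<^sup>2 * \<rho>\<^sup>2) + (4 * (g * C1) + C2) * (8 * L\<^sup>2 * \<rho> ^ 4)"
    and "0 \<le> sonata_Ahalf mu mt Dl D L \<rho>" by simp_all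
qed

text \<open>The small-gain lemma is applied with \<open>r = sqrt z\<close>; the margin
  \<open>r - \<rho>\<close> dominates \<open>sqrt (\<alpha> * Ah)\<close>, which is what the gain
  condition asks for.\<close>

lemma (in sonata_iteration) gap_linear_rate:
  assumes \<rho>: "\<rho> = sonata_rho TYPE('a) m w" and \<alpha>0: "0 < \<alpha>" and Dl: "Dl \<le> mt" and L0: "0 < L"
    and Ah: "Ah = sonata_Ahalf mu mt Dl D L \<rho>" and J: "J = sonata_J mu mt D"
    and amax: "ereal \<alpha> < sonata_amax Ah \<rho> mt Dl"
    and z: "z = (if \<alpha> < sonata_astar Ah J \<rho> then 1 - J * \<alpha> else (\<rho> + sqrt (\<alpha> * Ah))\<^sup>2)"
  obtains C where "\<And>n. gap n \<le> C * z ^ n" "0 < z"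
proof -
  define q where "q = (1 - \<alpha> / 2) * mt + Dl / 2 * \<alpha>"
  define g where "g = GPbar mu mt Dl D"
  define C1 where "C1 = sonata_C1 mu mt D L"
  define C2 where "C2 = sonata_C2 mt"
  define \<sigma> where "\<sigma> = 1 - \<alpha> * (q * mu / (q * mu + 2 * D\<^sup>2))"
  define \<eta> where "\<eta> = \<alpha> * ((q\<^sup>2 + D\<^sup>2) / (q * (q * mu + 2 * D\<^sup>2)))"
  have abar: "ereal \<alpha> < abar mt Dl" and aA: "Ah \<noteq> 0 \<Longrightarrow> \<alpha> < (1 - \<rho>)\<^sup>2 / Ah"
    using amax by (auto simp: sonata_amax_def)
  have \<rho>01: "0 \<le> \<rho>" "\<rho> \<le> 1" using rho_nonneg[OF \<rho>] rho_le_1[OF \<rho>] .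
  have q: "mt / 2 \<le> q" and gq: "(q\<^sup>2 + D\<^sup>2) / (q\<^sup>2 * mu) \<le> g"
    unfolding q_def g_def using step_curvature[OF mt mu Dl \<alpha>0 abar] .
  have q0: "q > 0" using q mt by simp
  have "0 < (q\<^sup>2 + D\<^sup>2) / (q\<^sup>2 * mu)" using q0 mu by (simp add: add_pos_nonneg)
  then have g0: "g > 0" using gq by linarith
  have "0 < D / mt + 1" using D mt by (simp add: add_nonneg_pos)
  then have "0 < (D / mt + 1)\<^sup>2" by simp
  then have C1: "C1 > 0" using mu by (simp add: C1_def sonata_C1_def add_pos_nonneg)
  have C2: "C2 > 0" using mt by (simp add: C2_def sonata_C2_def)
  have gC: "0 \<le> g * C1" using g0 C1 by simp
  note A2 = sonata_Ahalf_squared[OF less_imp_le[OF C2] less_imp_le[OF g0] less_imp_le[OF C1] C1_def C2_def g_def, of \<rho>, folded Ah]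
  \<comment> \<open>The first summand under the root is a positive multiple of
    \<open>\<rho>\<^sup>2\<close>, and the others are nonnegative.\<close>
  have A0: "\<rho> = 0" if "Ah = 0"
  proof (rule ccontr)
    assume "\<rho> \<noteq> 0"
    then have "0 < 8 * (g * C1) * L\<^sup>2 * \<rho>\<^sup>2" using g0 C1 L0 by simp
    moreover have "0 \<le> (4 * (g * C1) + C2) * (2 * L\<^sup>2 * \<rho>\<^sup>2)" "0 \<le> (4 * (g * C1) + C2) * (8 * L\<^sup>2 * \<rho> ^ 4)"
      using gC C2 by simp_all
    ultimately show False using A2(1)[unfolded that zero_power2] by linarith
  qed
  have "0 < mt * mu" using mt mu by simp
  then have "0 < mt * mu / (4 * D\<^sup>2 + mt * mu)" "mt * mu / (4 * D\<^sup>2 + mt * mu) \<le> 1"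
    by (simp_all add: add_nonneg_pos)
  then have J0: "0 < J" "J \<le> 1 / 2" unfolding J sonata_J_def by linarith+
  note rate = rate_dominates[OF A2(2) J0 \<rho>01 \<alpha>0 \<alpha>(2) A0 aA z]
  define r where "r = sqrt z"
  have r2: "r\<^sup>2 = z" using rate(3) by (simp add: r_def)
  \<comment> \<open>Strictness comes from \<open>sqrt (\<alpha> * Ah)\<close> when it is positive,
    and otherwise from \<rho> being 0 while z is positive.\<close>
  have r: "\<rho> < r"
  proof (cases "Ah = 0")
    case True
    then show ?thesis using A0 rate(3) by (simp add: r_def)
  next
    case False
    then have "0 < sqrt (\<alpha> * Ah)" using A2(2) \<alpha>0 by simp
    then show ?thesis using rate(2) unfolding r_def by linarith
  qed
  have "r < 1" using rate(4) by (simp add: r_def)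
  then have s: "0 < r - \<rho>" "r - \<rho> < 1" using r \<rho>01 by linarith+
  have "\<alpha> * Ah = (sqrt (\<alpha> * Ah))\<^sup>2" using \<alpha>0 A2(2) by simp
  also have "\<dots> \<le> (r - \<rho>)\<^sup>2" using rate(2) \<alpha>0 A2(2) by (intro power_mono) (auto simp: r_def)
  finally have sA: "\<alpha> * Ah \<le> (r - \<rho>)\<^sup>2" .
  have H: "0 \<le> 4 * (g * C1) + C2" using gC C2 by simp
  have gain: "8 * g * C1 * L\<^sup>2 * (\<alpha> * \<rho> / (r - \<rho>))\<^sup>2
      + (4 * g * C1 + C2) * (\<alpha> * L * \<rho> * (2 * \<rho> / (r - \<rho>) + 1) / (r - \<rho>))\<^sup>2 < 1"
    using gain_less_1[OF \<rho>01(1) s \<alpha>(1) L0 _ H A2 sA] g0 C1 by (simp add: mult.assoc)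
  note cr = contraction_vs_rate[OF q mt mu \<alpha>0 \<alpha>(2) rate(1)[unfolded J] gq, folded \<sigma>_def \<eta>_def]
  have "\<exists>C. \<forall>n. gap n \<le> C * (r\<^sup>2) ^ n"
  proof (rule small_gain[where X = xdev and Y = ydev and d = dir and g = g])
    show "gap (Suc n) \<le> \<sigma> * gap n + \<eta> * (4 * L\<^sup>2 * (xdev n)\<^sup>2 + 2 * (ydev n)\<^sup>2)" for n
      unfolding \<sigma>_def \<eta>_def by (rule gap_step[OF q_def q0])
    show "(dir n)\<^sup>2 \<le> C1 * gap n + C2 * (ydev n)\<^sup>2" for n
      unfolding C1_def C2_def by (rule dir_bound)
  qed (use \<rho>01 r cr g0 C1 C2 L \<alpha> gain gap_nonneg xdev_step[OF \<rho>] ydev_step[OF \<rho>] in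
      \<open>auto simp: r2 xdev_def ydev_def dir_def stacked_norm_nonneg\<close>)
  then show ?thesis using that rate(3) by (auto simp: r2)
qed

section \<open>From the given data to the abstract hypotheses\<close>

lemma doubly_stochastic_weights:
  assumes "m \<ge> 1" "weights_ok m E w"
  shows "doubly_stochastic m w"
proof
  fix i j assume ij: "i < m" "j < m"
  show "0 \<le> w i j"
  proof (cases "i = j")
    case True
    then show ?thesis using assms(2) ij by (auto simp: weights_ok_def less_imp_le)
  next
    case False
    then show ?thesis using assms(2) ij unfolding weights_ok_def by (metis less_imp_le order_refl)
  qed
qed (use assms in \<open>auto simp: weights_ok_def\<close>)

lemma convex_on_sum_functions:
  assumes "finite S" "convex K" "\<And>i. i \<in> S \<Longrightarrow> convex_on K (f i)"
  shows "convex_on K (\<lambda>x. \<Sum>i\<in>S. f i x)"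
  using assms by (induction S rule: finite_induct) (auto simp: convex_on_const)

text \<open>The quadratic growth of F beats any affine minorant of G. Such a minorant comes with the
  first surrogate minimiser, whose existence is part of the iteration.\<close>

lemma bdd_below_strongly_convex_plus_affine_minorant:
  fixes F G :: "'a::real_inner \<Rightarrow> real"
  assumes mu: "mu > 0"
    and F: "\<And>u. u \<in> K \<Longrightarrow> F a + g \<bullet> (u - a) + mu / 2 * (norm (u - a))\<^sup>2 \<le> F u"
    and G: "\<And>u. u \<in> K \<Longrightarrow> 0 \<le> h \<bullet> (u - a) + (G u - G a)"
  shows "bdd_below ((\<lambda>s. F s + G s) ` K)"
proof (rule bdd_belowI2)
  fix u assume u: "u \<in> K"
  define w where "w = g - h"
  have "0 \<le> (norm (w + mu *\<^sub>R (u - a)))\<^sup>2" by simp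
  also have "\<dots> = (norm w)\<^sup>2 + 2 * mu * (w \<bullet> (u - a)) + mu\<^sup>2 * (norm (u - a))\<^sup>2"
    unfolding power2_norm_eq_inner inner_add_left inner_add_right inner_scaleR_left inner_scaleR_right
    by (simp add: inner_commute power2_eq_square algebra_simps)
  finally have "- ((norm w)\<^sup>2 / (2 * mu)) \<le> w \<bullet> (u - a) + mu / 2 * (norm (u - a))\<^sup>2"
    using mu by (simp add: field_simps power2_eq_square)
  then show "F a + G a - (norm w)\<^sup>2 / (2 * mu) \<le> F u + G u"
    using F[OF u] G[OF u] by (simp add: w_def inner_diff_left)
qed

theorem theorem3p10:
  fixes m :: nat
    and K Opn :: "'a::euclidean_space set"
    and f :: "nat \<Rightarrow> 'a \<Rightarrow> real" and gf :: "nat \<Rightarrow> 'a \<Rightarrow> 'a" and hf :: "nat \<Rightarrow> 'a \<Rightarrow> 'a \<Rightarrow> 'a"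
    and mu L :: real and G :: "'a \<Rightarrow> real" and Li :: "nat \<Rightarrow> real"
    and E :: "(nat \<times> nat) set" and w :: "nat \<Rightarrow> nat \<Rightarrow> real"
    and tf :: "nat \<Rightarrow> 'a \<Rightarrow> 'a \<Rightarrow> real" and tgf :: "nat \<Rightarrow> 'a \<Rightarrow> 'a \<Rightarrow> 'a"
    and thf :: "nat \<Rightarrow> 'a \<Rightarrow> 'a \<Rightarrow> 'a \<Rightarrow> 'a"
    and mut Lt Dl Du :: "nat \<Rightarrow> real"
    and \<alpha> :: real
    and x y xhat :: "nat \<Rightarrow> nat \<Rightarrow> 'a"
  assumes m_pos: "m \<ge> 1"
    \<comment> \<open>Assumption (A)\<close>
    and K_ne: "K \<noteq> {}" and K_closed: "closed K" and K_convex: "convex K"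
    and O_open: "open Opn" and K_sub_O: "K \<subseteq> Opn"
    and f_deriv: "\<And>i z. i < m \<Longrightarrow> z \<in> Opn \<Longrightarrow> (f i has_derivative (\<lambda>h. gf i z \<bullet> h)) (at z)"
    and gf_deriv: "\<And>i z. i < m \<Longrightarrow> z \<in> Opn \<Longrightarrow> (gf i has_derivative hf i z) (at z)"
    and f_convex: "\<And>i. i < m \<Longrightarrow> convex_on Opn (f i)"
    and mu_pos: "mu > 0"
    and HF_bounds: "\<And>z h. z \<in> K \<Longrightarrow> mu * (norm h)\<^sup>2 \<le> h \<bullet> ((1 / real m) *\<^sub>R (\<Sum>k<m. hf k z h)) \<and> h \<bullet> ((1 / real m) *\<^sub>R (\<Sum>k<m. hf k z h)) \<le> L * (norm h)\<^sup>2"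
    and G_convex: "convex_on K G"
    and Li_bound: "\<And>i z h. i < m \<Longrightarrow> z \<in> K \<Longrightarrow> h \<bullet> hf i z h \<le> Li i * (norm h)\<^sup>2"
    \<comment> \<open>Assumptions (B) and (W)\<close>
    and graph: "undirected_connected_graph m E"
    and weights: "weights_ok m E w"
    \<comment> \<open>Assumption (C)\<close>
    and tf_C2: "\<And>i. i < m \<Longrightarrow> C2_on (Opn \<times> Opn) (\<lambda>p. tf i (fst p) (snd p))"
    and tgf_deriv: "\<And>i u v. i < m \<Longrightarrow> u \<in> Opn \<Longrightarrow> v \<in> Opn \<Longrightarrow>
                      ((\<lambda>s. tf i s v) has_derivative (\<lambda>h. tgf i u v \<bullet> h)) (at u)"
    and thf_deriv: "\<And>i u v. i < m \<Longrightarrow> u \<in> Opn \<Longrightarrow> v \<in> Opn \<Longrightarrow>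
                      ((\<lambda>s. tgf i s v) has_derivative thf i u v) (at u)"
    and tgf_consistent: "\<And>i u. i < m \<Longrightarrow> u \<in> K \<Longrightarrow> tgf i u u = gf i u"
    and tgf_lipschitz: "\<And>i v. i < m \<Longrightarrow> v \<in> K \<Longrightarrow> lipschitz_on (Lt i) K (\<lambda>s. tgf i s v)"
    and mut_pos: "\<And>i. i < m \<Longrightarrow> mut i > 0"
    and tf_strongly_convex: "\<And>i v. i < m \<Longrightarrow> v \<in> K \<Longrightarrow> strongly_convex_with K (\<lambda>s. tf i s v) (mut i)"
    and Dl_le_Du: "\<And>i. i < m \<Longrightarrow> Dl i \<le> Du i"
    and D_bounds: "\<And>i u v h. i < m \<Longrightarrow> u \<in> K \<Longrightarrow> v \<in> K \<Longrightarrow>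
                      Dl i * (norm h)\<^sup>2 \<le> h \<bullet> thf i u v h - h \<bullet> ((1 / real m) *\<^sub>R (\<Sum>k<m. hf k u h)) \<and>
                      h \<bullet> thf i u v h - h \<bullet> ((1 / real m) *\<^sub>R (\<Sum>k<m. hf k u h)) \<le> Du i * (norm h)\<^sup>2"
    and mut_ge_Dl: "Min (mut ` {..<m}) \<ge> Min (Dl ` {..<m})"
    \<comment> \<open>SONATA iterates with step-size alpha\<close>
    and x0: "\<And>i. i < m \<Longrightarrow> x 0 i \<in> K"
    and y0: "\<And>i. i < m \<Longrightarrow> y 0 i = gf i (x 0 i)"
    and xhat_def: "\<And>\<nu> i. i < m \<Longrightarrow> is_arg_min
                      (\<lambda>s. tf i s (x \<nu> i) + (y \<nu> i - gf i (x \<nu> i)) \<bullet> (s - x \<nu> i) + G s)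
                      (\<lambda>s. s \<in> K) (xhat \<nu> i)"
    and x_step: "\<And>\<nu> i. i < m \<Longrightarrow>
                   x (Suc \<nu>) i = (\<Sum>j<m. w i j *\<^sub>R (x \<nu> j + \<alpha> *\<^sub>R (xhat \<nu> j - x \<nu> j)))"
    and y_step: "\<And>\<nu> i. i < m \<Longrightarrow>
                   y (Suc \<nu>) i = (\<Sum>j<m. w i j *\<^sub>R (y \<nu> j + gf j (x (Suc \<nu>) j) - gf j (x \<nu> j)))"
    \<comment> \<open>step-size range\<close>
    and alpha_pos: "0 < \<alpha>" and alpha_lt: "ereal \<alpha> < sonata_alpha_max m mu mut Dl Du Li (sonata_rho TYPE('a) m w)"
  shows "\<forall>i<m. (\<lambda>\<nu>. ((1 / real m) * (\<Sum>k<m. f k (x \<nu> i)) + G (x \<nu> i))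
         - Inf ((\<lambda>s. (1 / real m) * (\<Sum>k<m. f k s) + G s) ` K))
       \<in> O(\<lambda>\<nu>. (sonata_z m mu mut Dl Du Li (sonata_rho TYPE('a) m w) \<alpha>) ^ \<nu>)"
proof -
  define F where "F s = (1 / real m) * (\<Sum>k<m. f k s)" for s
  define gF where "gF s = average m (\<lambda>k. gf k s)" for s
  define hF where "hF s h = (1 / real m) *\<^sub>R (\<Sum>k<m. hf k s h)" for s h
  define mt where "mt = Min (mut ` {..<m})"
  define DL where "DL = Min (Dl ` {..<m})"
  define D where "D = sonata_Dmax m Dl Du"
  define LL where "LL = Max (Li ` {..<m})"
  define \<rho> where "\<rho> = sonata_rho TYPE('a) m w"
  define T where "T n i s = tf i s (x n i)" for n i s
  define tg where "tg n i s = tgf i s (x n i)" for n i s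
  interpret W: doubly_stochastic m w using doubly_stochastic_weights[OF m_pos weights] .
  have ne: "{..<m} \<noteq> {}" using m_pos by (auto simp: lessThan_empty_iff)
  have mt_le: "mt \<le> mut i" and DL_le: "DL \<le> Dl i" and LL_ge: "Li i \<le> LL"
    and D_ge: "\<bar>Dl i\<bar> \<le> D" "\<bar>Du i\<bar> \<le> D" if "i < m" for i
  proof -
    have "max \<bar>Dl i\<bar> \<bar>Du i\<bar> \<le> D"
      unfolding D_def sonata_Dmax_def using that by (intro Max_ge) auto
    then show "\<bar>Dl i\<bar> \<le> D" "\<bar>Du i\<bar> \<le> D" by auto
  qed (use that in \<open>auto simp: mt_def DL_def LL_def\<close>)
  have mt0: "mt > 0" unfolding mt_def using mut_pos ne by (subst Min_gr_iff) auto
  have D0: "0 \<le> D" using D_ge[of 0] m_pos by fastforce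
  have dF: "(F has_derivative (\<lambda>h. gF s \<bullet> h)) (at s)" if "s \<in> Opn" for s
  proof -
    have "((\<lambda>s. (1 / real m) * (\<Sum>k<m. f k s)) has_derivative (\<lambda>h. (1 / real m) * (\<Sum>k<m. gf k s \<bullet> h))) (at s)"
      by (intro has_derivative_mult_right has_derivative_sum f_deriv that) auto
    then show ?thesis by (simp add: F_def[abs_def] gF_def average_def inner_sum_left)
  qed
  have dgF: "(gF has_derivative hF s) (at s)" if "s \<in> Opn" for s
    unfolding gF_def[abs_def] hF_def[abs_def] average_def
    by (intro has_derivative_scaleR_right has_derivative_sum gf_deriv that) auto
  have KO: "s \<in> Opn" if "s \<in> K" for s using that K_sub_O by blast
  have F_sc: "F a + gF a \<bullet> (b - a) + mu / 2 * (norm (b - a))\<^sup>2 \<le> F b" if "a \<in> K" "b \<in> K" for a b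
  proof (rule strongly_convex_lower_bound[OF K_convex dF[OF KO] _ that])
    show "mu * (norm (b - a))\<^sup>2 \<le> (gF b - gF a) \<bullet> (b - a)" if "a \<in> K" "b \<in> K" for a b
      using gradient_strongly_monotone[OF K_convex dgF[OF KO] _ that] HF_bounds by (simp add: hF_def)
  qed
  have F_convex: "convex_on K F"
  proof -
    have "convex_on K (f k)" if "k < m" for k
      using f_convex[OF that] K_sub_O K_convex by (rule convex_on_subset)
    then have "convex_on K (\<lambda>s. \<Sum>k<m. f k s)"
      using K_convex by (intro convex_on_sum_functions) auto
    then show ?thesis unfolding F_def[abs_def] by (intro convex_on_cmul) auto
  qed
  \<comment> \<open>Convexity gives a nonnegative Hessian form, so the upper bound
    \<open>Li i\<close> bounds its absolute value.\<close>
  have Lip: "norm (gf i b - gf i a) \<le> LL * norm (b - a)" if i: "i < m" and ab: "a \<in> K" "b \<in> K" for i a b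
  proof (rule gradient_lipschitz_of_hessian_bound[OF O_open K_sub_O K_convex f_deriv[OF i] gf_deriv[OF i KO] _ ab])
    fix s h :: 'a assume s: "s \<in> K"
    have "0 \<le> h \<bullet> hf i s h"
      using convex_hessian_nonneg[OF O_open KO[OF s] f_convex[OF i] f_deriv[OF i] gf_deriv[OF i KO[OF s]]] .
    moreover have "Li i * (norm h)\<^sup>2 \<le> LL * (norm h)\<^sup>2" using LL_ge[OF i] by (rule mult_right_mono) simp
    ultimately show "\<bar>h \<bullet> hf i s h\<bar> \<le> LL * (norm h)\<^sup>2" using Li_bound[OF i s, of h] by linarith
  qed
  \<comment> \<open>Along a unit vector the mean Hessian form is at least \<open>mu\<close> and at
    most \<open>LL\<close>.\<close>
  have LL0: "LL > 0"
  proof -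
    obtain s where s: "s \<in> K" using K_ne by blast
    obtain h :: 'a where h: "norm h = 1" using vector_choose_size[of 1] by auto
    have "mu \<le> (1 / real m) * (\<Sum>k<m. h \<bullet> hf k s h)"
      using HF_bounds[OF s, of h] h by (simp add: inner_sum_right)
    also have "\<dots> \<le> (1 / real m) * (\<Sum>k<m. LL)"
    proof (intro mult_left_mono sum_mono)
      fix k assume "k \<in> {..<m}"
      then show "h \<bullet> hf k s h \<le> LL" using Li_bound[of k s h] LL_ge[of k] s h by simp
    qed simp
    also have "\<dots> = LL" using m_pos by simp
    finally show ?thesis using mu_pos by simp
  qed
  have xhK: "xhat n i \<in> K" if "i < m" for n i
    using xhat_def[OF that, of n] by (simp add: is_arg_min_def)
  have \<alpha>1: "\<alpha> < 1" using alpha_lt by (auto simp: sonata_alpha_max_def sonata_amax_def)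
  have xK: "\<forall>i<m. x n i \<in> K" for n
  proof (induction n)
    case (Suc n)
    have "x n j + \<alpha> *\<^sub>R (xhat n j - x n j) \<in> K" if "j < m" for j
      using convexD_alt[OF K_convex, of "x n j" "xhat n j" \<alpha>] Suc xhK[OF that] that alpha_pos \<alpha>1
      by (simp add: algebra_simps)
    then show ?case
      using x_step by (auto intro!: convex_sum K_convex simp: W.row_sum W.nonneg)
  qed (use x0 in blast)
  \<comment> \<open>Consistency of the surrogate at its base point replaces
    \<open>gf i (x n i)\<close> by the surrogate gradient there.\<close>
  have opt: "0 \<le> (tg n i (xhat n i) + y n i - tg n i (x n i)) \<bullet> (u - xhat n i) + (G u - G (xhat n i))"
    if i: "i < m" and u: "u \<in> K" for n i u
  proof (rule directional_optimality[where g = "\<lambda>s. tf i s (x n i) + (y n i - gf i (x n i)) \<bullet> (s - x n i)"])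
    have "((\<lambda>s. tf i s (x n i) + (y n i - gf i (x n i)) \<bullet> (s - x n i)) has_derivative
        (\<lambda>h. tgf i (xhat n i) (x n i) \<bullet> h + (y n i - gf i (x n i)) \<bullet> (h - 0))) (at (xhat n i))"
      using xK i by (intro derivative_intros tgf_deriv KO xhK) auto
    then show "((\<lambda>s. tf i s (x n i) + (y n i - gf i (x n i)) \<bullet> (s - x n i)) has_derivative
        (\<lambda>h. (tg n i (xhat n i) + y n i - tg n i (x n i)) \<bullet> h)) (at (xhat n i))"
      using tgf_consistent[OF i] xK i by (simp add: tg_def inner_add_left inner_diff_left add_diff_eq)
    fix t :: real assume t: "0 < t" "t < 1"
    have in_K: "xhat n i + t *\<^sub>R (u - xhat n i) \<in> K"
      using convexD_alt[OF K_convex xhK[OF i, of n] u, of t] t by (simp add: algebra_simps)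
    have "G (xhat n i + t *\<^sub>R (u - xhat n i)) \<le> (1 - t) * G (xhat n i) + t * G u"
      using convex_onD[OF G_convex, of t "xhat n i" u] xhK[OF i, of n] u t by (simp add: algebra_simps)
    moreover have "tf i (xhat n i) (x n i) + (y n i - gf i (x n i)) \<bullet> (xhat n i - x n i) + G (xhat n i)
      \<le> tf i (xhat n i + t *\<^sub>R (u - xhat n i)) (x n i)
        + (y n i - gf i (x n i)) \<bullet> (xhat n i + t *\<^sub>R (u - xhat n i) - x n i) + G (xhat n i + t *\<^sub>R (u - xhat n i))"
      using xhat_def[OF i, of n] in_K unfolding is_arg_min_def by (meson not_less)
    ultimately show "0 \<le> tf i (xhat n i + t *\<^sub>R (u - xhat n i)) (x n i)
        + (y n i - gf i (x n i)) \<bullet> (xhat n i + t *\<^sub>R (u - xhat n i) - x n i)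
        - (tf i (xhat n i) (x n i) + (y n i - gf i (x n i)) \<bullet> (xhat n i - x n i)) + t * (G u - G (xhat n i))"
      by (simp add: left_diff_distrib right_diff_distrib)
  qed
  \<comment> \<open>Without a lower bound the real \<open>Inf\<close> would be an unspecified value
    rather than the optimal value.\<close>
  have bdd: "bdd_below ((\<lambda>s. F s + G s) ` K)"
  proof (rule bdd_below_strongly_convex_plus_affine_minorant[OF mu_pos])
    have m0: "0 < m" using m_pos by simp
    show "F (xhat 0 0) + gF (xhat 0 0) \<bullet> (u - xhat 0 0) + mu / 2 * (norm (u - xhat 0 0))\<^sup>2 \<le> F u"
      if "u \<in> K" for u
      using F_sc[OF xhK[OF m0] that] .
    show "0 \<le> (tg 0 0 (xhat 0 0) + y 0 0 - tg 0 0 (x 0 0)) \<bullet> (u - xhat 0 0) + (G u - G (xhat 0 0))"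
      if "u \<in> K" for u
      using opt[OF m0 that] .
  qed
  obtain xs c where xs: "xs \<in> K" "F xs + c = Inf ((\<lambda>s. F s + G s) ` K)"
    and c_lower: "\<forall>b g. (\<forall>v\<in>K. b \<le> G v + g \<bullet> v) \<longrightarrow> b \<le> c + g \<bullet> xs"
    and xs_opt: "\<forall>v\<in>K. 0 \<le> gF xs \<bullet> (v - xs) + (G v - c)"
    by (rule composite_infimum_point[OF K_ne K_closed mu_pos dF[OF KO] F_sc G_convex bdd])
  \<comment> \<open>Individual constants are weakened to the uniform \<open>mt\<close>,
    \<open>DL\<close> and \<open>D\<close>, so that all agents share one contraction factor.\<close>
  have agent: "surrogate_step K F G (T n i) gF (tg n i) mu mt DL D (x n i) (xhat n i) (y n i) xs c"
    if i: "i < m" for n i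
  proof
    have xn: "x n i \<in> K" using xK i by blast
    have dT: "(T n i has_derivative (\<lambda>h. tg n i s \<bullet> h)) (at s)" if "s \<in> Opn" for s
      unfolding T_def[abs_def] tg_def using that by (rule tgf_deriv[OF i _ KO[OF xn]])
    have dD: "((\<lambda>s. T n i s - F s) has_derivative (\<lambda>h. (tg n i s - gF s) \<bullet> h)) (at s)" if "s \<in> Opn" for s
      using has_derivative_diff[OF dT[OF that] dF[OF that]] by (simp add: inner_diff_left)
    have hD: "((\<lambda>s. tg n i s - gF s) has_derivative (\<lambda>h. thf i s (x n i) h - hF s h)) (at s)" if "s \<in> K" for s
      unfolding tg_def by (intro has_derivative_diff dgF thf_deriv KO that xn i)
    have bD: "Dl i * (norm h)\<^sup>2 \<le> h \<bullet> (thf i s (x n i) h - hF s h)"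
      "h \<bullet> (thf i s (x n i) h - hF s h) \<le> Du i * (norm h)\<^sup>2" if "s \<in> K" for s h
      using D_bounds[OF i that xn, of h] by (simp_all add: hF_def inner_diff_right)
    show "T n i a + tg n i a \<bullet> (b - a) + mt / 2 * (norm (b - a))\<^sup>2 \<le> T n i b" if ab: "a \<in> K" "b \<in> K" for a b
    proof -
      have "strongly_convex_with K (T n i) (mut i)"
        unfolding T_def[abs_def] by (rule tf_strongly_convex[OF i xn])
      from strongly_convex_with_gradient_inequality[OF this ab dT[OF KO[OF ab(1)]]]
      have "T n i a + tg n i a \<bullet> (b - a) + mut i / 2 * (norm (b - a))\<^sup>2 \<le> T n i b" .
      moreover have "mt / 2 * (norm (b - a))\<^sup>2 \<le> mut i / 2 * (norm (b - a))\<^sup>2"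
        using mt_le[OF i] by (intro mult_right_mono) auto
      ultimately show ?thesis by linarith
    qed
    show "T n i a - F a + (tg n i a - gF a) \<bullet> (b - a) + DL / 2 * (norm (b - a))\<^sup>2 \<le> T n i b - F b"
      if ab: "a \<in> K" "b \<in> K" for a b
    proof (rule strongly_convex_lower_bound[OF K_convex dD[OF KO] _ ab])
      show "DL * (norm (b - a))\<^sup>2 \<le> (tg n i b - gF b - (tg n i a - gF a)) \<bullet> (b - a)"
        if "a \<in> K" "b \<in> K" for a b
      proof (rule gradient_strongly_monotone[OF K_convex hD _ that])
        fix s h :: 'a assume s: "s \<in> K"
        have "DL * (norm h)\<^sup>2 \<le> Dl i * (norm h)\<^sup>2" using DL_le[OF i] by (rule mult_right_mono) simp
        then show "DL * (norm h)\<^sup>2 \<le> h \<bullet> (thf i s (x n i) h - hF s h)" using bD(1)[OF s, of h] by linarith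
      qed
    qed
    show "norm (tg n i b - gF b - (tg n i a - gF a)) \<le> D * norm (b - a)" if ab: "a \<in> K" "b \<in> K" for a b
    proof (rule gradient_lipschitz_of_hessian_bound[OF O_open K_sub_O K_convex dD hD _ ab])
      fix s h :: 'a assume s: "s \<in> K"
      have "Du i * (norm h)\<^sup>2 \<le> D * (norm h)\<^sup>2" "- (D * (norm h)\<^sup>2) \<le> Dl i * (norm h)\<^sup>2"
        using mult_right_mono[of "Du i" D "(norm h)\<^sup>2"] mult_right_mono[of "- D" "Dl i" "(norm h)\<^sup>2"] D_ge[OF i]
        by auto
      then show "\<bar>h \<bullet> (thf i s (x n i) h - hF s h)\<bar> \<le> D * (norm h)\<^sup>2"
        using bD[OF s, of h] by linarith
    qed
    show "F a + gF a \<bullet> (b - a) + mu / 2 * (norm (b - a))\<^sup>2 \<le> F b" if "a \<in> K" "b \<in> K" for a b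
      using that by (rule F_sc)
    show "0 \<le> (tg n i (xhat n i) + y n i - tg n i (x n i)) \<bullet> (u - xhat n i) + (G u - G (xhat n i))"
      if "u \<in> K" for u
      using i that by (rule opt)
    show "b \<le> c + g \<bullet> xs" if "\<And>v. v \<in> K \<Longrightarrow> b \<le> G v + g \<bullet> v" for b g
      using c_lower that by blast
    show "0 \<le> gF xs \<bullet> (v - xs) + (G v - c)" if "v \<in> K" for v
      using xs_opt that by blast
    show "x n i \<in> K" by (rule xn)
  qed (fact mu_pos mt0 F_convex G_convex xhK[OF i] xs(1))+
  interpret S: sonata_iteration m w K F G T gF gf tg mu mt DL D LL \<alpha> x xhat y xs c
  proof (rule sonata_iteration.intro[OF W.doubly_stochastic_axioms sonata_iteration_axioms.intro])
    show "surrogate_step K F G (T n i) gF (tg n i) mu mt DL D (x n i) (xhat n i) (y n i) xs c" if "i < m" for n i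
      using that by (rule agent)
    show "norm (gf i b - gf i a) \<le> LL * norm (b - a)" if "i < m" "a \<in> K" "b \<in> K" for i a b
      using that by (rule Lip)
    show "x (Suc n) i = mix m w (\<lambda>j. x n j + \<alpha> *\<^sub>R (xhat n j - x n j)) i" if "i < m" for n i
      unfolding mix_def using that by (rule x_step)
    show "y (Suc n) i = mix m w (\<lambda>j. y n j + (gf j (x (Suc n) j) - gf j (x n j))) i" if "i < m" for n i
      unfolding mix_def add_diff_eq using that by (rule y_step)
    show "y 0 i = gf i (x 0 i)" if "i < m" for i
      using that by (rule y0)
  qed (use gF_def LL0 D0 alpha_pos \<alpha>1 in auto)
  define Ah where "Ah = sonata_Ahalf mu mt DL D LL \<rho>"
  define z where "z = sonata_z m mu mut Dl Du Li \<rho> \<alpha>"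
  have amax: "ereal \<alpha> < sonata_amax Ah \<rho> mt DL"
    using alpha_lt unfolding sonata_alpha_max_def sonata_Ah_of_def Ah_def mt_def DL_def D_def LL_def \<rho>_def .
  \<comment> \<open>The minimum with the maximal step-size in \<open>sonata_z\<close> disappears
    because \<alpha> lies below that maximum.\<close>
  have z: "z = (if \<alpha> < sonata_astar Ah (sonata_J mu mt D) \<rho> then 1 - sonata_J mu mt D * \<alpha>
      else (\<rho> + sqrt (\<alpha> * Ah))\<^sup>2)"
    using alpha_lt
    by (simp add: z_def sonata_z_def sonata_alpha_star_def sonata_Ah_of_def sonata_J_of_def Ah_def
        mt_def DL_def D_def LL_def \<rho>_def)
  obtain C where C: "\<And>n. S.gap n \<le> C * z ^ n" "0 < z"
    using S.gap_linear_rate[OF \<rho>_def alpha_pos _ LL0 Ah_def refl amax z] mut_ge_Dl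
    unfolding mt_def[symmetric] DL_def[symmetric] by blast
  show ?thesis
  proof (intro allI impI)
    fix i assume i: "i < m"
    have "(\<lambda>n. F (x n i) + G (x n i) - (F xs + c)) \<in> O(\<lambda>n. z ^ n)"
    proof (rule bigoI[of _ C], rule always_eventually, rule allI)
      fix n
      show "norm (F (x n i) + G (x n i) - (F xs + c)) \<le> C * norm (z ^ n)"
        using order_trans[OF S.agent_gap_le[OF i] C(1)[of n]] S.agent_gap_nonneg[OF i, of n] C(2) by simp
    qed
    then show "(\<lambda>\<nu>. ((1 / real m) * (\<Sum>k<m. f k (x \<nu> i)) + G (x \<nu> i))
         - Inf ((\<lambda>s. (1 / real m) * (\<Sum>k<m. f k s) + G s) ` K))
       \<in> O(\<lambda>\<nu>. (sonata_z m mu mut Dl Du Li (sonata_rho TYPE('a) m w) \<alpha>) ^ \<nu>)"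
      unfolding xs(2) unfolding z_def \<rho>_def F_def .
  qed
qed

end
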